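(* Let $\rho : B_4 \to B_4$ be a homomorphism. Then either $\rho$ factors through the exceptional homomorphism $B_4 \to B_3$ (that is, $\rho$ is the composition of the exceptional homomorphism with some homomorphism $B_3\to B_4$), or $\rho$ is equivalent to either the trivial map or the identity map.
   Context: $B_n$ is the braid group on $n$ strands with standard generators $\sigma_1,\dots,\sigma_{n-1}$. The exceptional homomorphism $B_4\to B_3$ is given by $\sigma_1,\sigma_3\mapsto\sigma_1$ and $\sigma_2\mapsto\sigma_2$. Let $G$ be a group. A homomorphism $\rho_1:B_n\to G$ is almost-conjugate to $\rho_0:B_n\to G$ if $\rho_1=A\circ\rho_0$ for some $A\in\operatorname{Aut}G$. Given $\rho:B_n\to G$ and $t\in G$ such that $\sigma_i\mapsto\rho(\sigma_i)t$ (all $i$) extends to a homomorphism $B_n\to G$, that homomorphism is denoted $\rho^t$ and called a transvection of $\rho$. Two homomorphisms $B_n\to G$ are equivalent if one is almost-conjugate to a transvection of the other (this is an equivalence relation). *)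

theory Defs
  imports "HOL-Algebra.Group"
begin

datatype 'a letter = Gen 'a | Inv 'a

fun inv_letter :: "'a letter \<Rightarrow> 'a letter" where
  "inv_letter (Gen i) = Inv i"
| "inv_letter (Inv i) = Gen i"

type_synonym braid_word = "nat letter list"

type_synonym braid = "braid_word set"

definition braid_words :: "nat \<Rightarrow> braid_word set" where
  "braid_words n = {w. \<forall>a\<in>set w. set_letter a \<subseteq> {1..<n}}"

text \<open>The congruence on words that defines Artin's presentation of the braid group on
  \<open>n\<close> strands, with generators indexed by \<open>1, \<dots>, n - 1\<close>.\<close>

inductive braid_eq :: "nat \<Rightarrow> braid_word \<Rightarrow> braid_word \<Rightarrow> bool" for n :: nat where
  refl: "w \<in> braid_words n \<Longrightarrow> braid_eq n w w"
| sym: "braid_eq n u v \<Longrightarrow> braid_eq n v u"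
| trans: "braid_eq n u v \<Longrightarrow> braid_eq n v w \<Longrightarrow> braid_eq n u w"
| append: "braid_eq n u u' \<Longrightarrow> braid_eq n v v' \<Longrightarrow> braid_eq n (u @ v) (u' @ v')"
| cancel: "[a] \<in> braid_words n \<Longrightarrow> braid_eq n [a, inv_letter a] []"
| commute: "i \<in> {1..<n} \<Longrightarrow> j \<in> {1..<n} \<Longrightarrow> i + 1 < j \<Longrightarrow>
    braid_eq n [Gen i, Gen j] [Gen j, Gen i]"
| braid: "i \<in> {1..<n} \<Longrightarrow> i + 1 \<in> {1..<n} \<Longrightarrow>
    braid_eq n [Gen i, Gen (i + 1), Gen i] [Gen (i + 1), Gen i, Gen (i + 1)]"

definition braid_rel :: "nat \<Rightarrow> (braid_word \<times> braid_word) set" where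
  "braid_rel n = {(u, v). braid_eq n u v}"

definition braid_class :: "nat \<Rightarrow> braid_word \<Rightarrow> braid" where
  "braid_class n w = braid_rel n `` {w}"

text \<open>The unions below are over representatives of congruence classes; all their members
  coincide, by \<open>braid_mult_class\<close> and \<open>exceptional_class\<close>.\<close>

definition braid_group :: "nat \<Rightarrow> braid monoid" where
  "braid_group n =
    \<lparr>carrier = braid_words n // braid_rel n,
     mult = (\<lambda>X Y. \<Union>u\<in>X. \<Union>v\<in>Y. braid_class n (u @ v)),
     one = braid_class n []\<rparr>"

definition braid_gen :: "nat \<Rightarrow> nat \<Rightarrow> braid" where
  "braid_gen n i = braid_class n [Gen i]"

definition exceptional :: "braid \<Rightarrow> braid" where
  "exceptional X =
    (\<Union>w\<in>X. braid_class 3 (map (map_letter (\<lambda>i. if i = 3 then 1 else i)) w))"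

definition almost_conjugate ::
    "nat \<Rightarrow> ('a, 'm) monoid_scheme \<Rightarrow> (braid \<Rightarrow> 'a) \<Rightarrow> (braid \<Rightarrow> 'a) \<Rightarrow> bool" where
  "almost_conjugate n G \<rho>1 \<rho>0 \<longleftrightarrow>
    (\<exists>A\<in>iso G G. \<forall>x\<in>carrier (braid_group n). \<rho>1 x = A (\<rho>0 x))"

definition transvection ::
    "nat \<Rightarrow> ('a, 'm) monoid_scheme \<Rightarrow> (braid \<Rightarrow> 'a) \<Rightarrow> (braid \<Rightarrow> 'a) \<Rightarrow> bool" where
  "transvection n G \<rho>' \<rho> \<longleftrightarrow>
    \<rho>' \<in> hom (braid_group n) G \<and>
    (\<exists>t\<in>carrier G. \<forall>i\<in>{1..<n}. \<rho>' (braid_gen n i) = \<rho> (braid_gen n i) \<otimes>\<^bsub>G\<^esub> t)"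

definition hom_equivalent ::
    "nat \<Rightarrow> ('a, 'm) monoid_scheme \<Rightarrow> (braid \<Rightarrow> 'a) \<Rightarrow> (braid \<Rightarrow> 'a) \<Rightarrow> bool" where
  "hom_equivalent n G \<rho>1 \<rho>0 \<longleftrightarrow>
    (\<exists>\<tau>. transvection n G \<tau> \<rho>0 \<and> almost_conjugate n G \<rho>1 \<tau>) \<or>
    (\<exists>\<tau>. transvection n G \<tau> \<rho>1 \<and> almost_conjugate n G \<rho>0 \<tau>)"

lemma set_letter_inv [simp]: "set_letter (inv_letter a) = set_letter a"
  by (cases a) auto

lemma inv_letter_inv [simp]: "inv_letter (inv_letter a) = a"
  by (cases a) auto

lemma braid_words_append [simp]:
  "u @ v \<in> braid_words n \<longleftrightarrow> u \<in> braid_words n \<and> v \<in> braid_words n"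
  by (auto simp: braid_words_def)

lemma braid_words_Nil [simp]: "[] \<in> braid_words n"
  by (simp add: braid_words_def)

lemma braid_eq_words: "braid_eq n u v \<Longrightarrow> u \<in> braid_words n \<and> v \<in> braid_words n"
  by (induction rule: braid_eq.induct) (auto simp: braid_words_def)

lemma equiv_braid_rel: "equiv (braid_words n) (braid_rel n)"
proof (rule equivI)
  show "braid_rel n \<subseteq> braid_words n \<times> braid_words n"
    using braid_eq_words by (auto simp: braid_rel_def)
  show "refl_on (braid_words n) (braid_rel n)"
    by (simp add: refl_on_def braid_rel_def braid_eq.refl)
  show "Relation.sym (braid_rel n)"
    unfolding sym_def braid_rel_def using braid_eq.sym by blast
  show "Relation.trans (braid_rel n)"
    unfolding trans_def braid_rel_def using braid_eq.trans by blast
qed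

lemma braid_class_eq:
  "u \<in> braid_words n \<Longrightarrow> v \<in> braid_words n \<Longrightarrow>
    braid_class n u = braid_class n v \<longleftrightarrow> braid_eq n u v"
  using eq_equiv_class_iff[OF equiv_braid_rel, of u n v]
  by (simp add: braid_class_def braid_rel_def)

lemma carrier_braid_group: "carrier (braid_group n) = braid_class n ` braid_words n"
  by (auto simp: braid_group_def quotient_def braid_class_def)

lemma one_braid_group: "\<one>\<^bsub>braid_group n\<^esub> = braid_class n []"
  by (simp add: braid_group_def)

lemma braid_mult_class:
  assumes "u \<in> braid_words n" "v \<in> braid_words n"
  shows "braid_class n u \<otimes>\<^bsub>braid_group n\<^esub> braid_class n v = braid_class n (u @ v)"
proof -
  have "braid_class n (x @ y) = braid_class n (u @ v)"
    if "x \<in> braid_class n u" "y \<in> braid_class n v" for x y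
  proof -
    have "braid_eq n u x" "braid_eq n v y"
      using that by (auto simp: braid_class_def braid_rel_def)
    then have "braid_eq n (x @ y) (u @ v)"
      by (blast intro: braid_eq.append dest: braid_eq.sym)
    then show ?thesis
      using braid_class_eq braid_eq_words by blast
  qed
  moreover have "u \<in> braid_class n u" "v \<in> braid_class n v"
    using assms by (auto simp: braid_class_def braid_rel_def intro: braid_eq.refl)
  ultimately show ?thesis
    unfolding braid_group_def monoid.simps by blast
qed

lemma braid_eq_left_inverse:
  "w \<in> braid_words n \<Longrightarrow> braid_eq n (rev (map inv_letter w) @ w) []"
proof (induction w)
  case Nil
  then show ?case by (simp add: braid_eq.refl)
next
  case (Cons a w)
  have w: "w \<in> braid_words n" and a: "[inv_letter a] \<in> braid_words n"
    using Cons.prems by (auto simp: braid_words_def)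
  let ?r = "rev (map inv_letter w)"
  have r: "?r \<in> braid_words n"
    using w by (auto simp: braid_words_def)
  have "braid_eq n [inv_letter a, a] []"
    using braid_eq.cancel[OF a] by simp
  then have "braid_eq n (?r @ [inv_letter a, a] @ w) (?r @ [] @ w)"
    by (intro braid_eq.append braid_eq.refl r w)
  then have "braid_eq n (rev (map inv_letter (a # w)) @ a # w) (?r @ w)"
    by simp
  then show ?case
    using Cons.IH[OF w] by (rule braid_eq.trans)
qed

lemma group_braid_group: "group (braid_group n)"
proof (rule groupI)
  fix x assume "x \<in> carrier (braid_group n)"
  then obtain w where w: "w \<in> braid_words n" "x = braid_class n w"
    by (auto simp: carrier_braid_group)
  let ?r = "rev (map inv_letter w)"
  have r: "?r \<in> braid_words n"
    using w by (auto simp: braid_words_def)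
  have "braid_class n ?r \<otimes>\<^bsub>braid_group n\<^esub> x = \<one>\<^bsub>braid_group n\<^esub>"
    using w r braid_eq_left_inverse[OF w(1)] braid_class_eq[of "?r @ w" n "[]"]
    by (simp add: braid_mult_class one_braid_group)
  then show "\<exists>y\<in>carrier (braid_group n). y \<otimes>\<^bsub>braid_group n\<^esub> x = \<one>\<^bsub>braid_group n\<^esub>"
    using r by (auto simp: carrier_braid_group)
qed (auto simp: carrier_braid_group one_braid_group braid_mult_class)

lemma braid_gen_closed: "i \<in> {1..<n} \<Longrightarrow> braid_gen n i \<in> carrier (braid_group n)"
  by (auto simp: braid_gen_def carrier_braid_group braid_words_def)

lemma exceptional_braid_eq:
  "braid_eq 4 u v \<Longrightarrow>
    braid_eq 3 (map (map_letter (\<lambda>i. if i = 3 then 1 else i)) u)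
      (map (map_letter (\<lambda>i. if i = 3 then 1 else i)) v)"
proof (induction rule: braid_eq.induct)
  case (refl w)
  then show ?case
    by (intro braid_eq.refl) (fastforce simp: braid_words_def letter.set_map)
next
  case (cancel a)
  have "[map_letter (\<lambda>i. if i = 3 then 1 else i) a] \<in> braid_words 3"
    using cancel by (fastforce simp: braid_words_def letter.set_map)
  moreover have "map_letter f (inv_letter a) = inv_letter (map_letter f a)" for f :: "nat \<Rightarrow> nat"
    by (cases a) auto
  ultimately show ?case
    using braid_eq.cancel by simp
next
  case (commute i j)
  then have "i = 1" "j = 3" by auto
  then show ?case
    by (auto simp: braid_words_def intro!: braid_eq.refl)
next
  case (braid i)
  then consider "i = 1" | "i = 2" by fastforce
  then show ?case
    using braid_eq.braid[of 1 3] braid_eq.sym[OF braid_eq.braid[of 1 3]]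
    by cases (auto simp: numeral_eq_Suc)
next
  case (sym u v)
  show ?case by (rule braid_eq.sym[OF sym.IH])
next
  case (trans u v w)
  show ?case by (rule braid_eq.trans[OF trans.IH])
next
  case (append u u' v v')
  show ?case using braid_eq.append[OF append.IH] by simp
qed

lemma exceptional_class:
  assumes "w \<in> braid_words 4"
  shows "exceptional (braid_class 4 w) =
    braid_class 3 (map (map_letter (\<lambda>i. if i = 3 then 1 else i)) w)"
proof -
  let ?f = "map (map_letter (\<lambda>i::nat. if i = 3 then 1 else i))"
  have "braid_class 3 (?f v) = braid_class 3 (?f w)" if "v \<in> braid_class 4 w" for v
  proof -
    have "braid_eq 4 v w"
      using that by (auto simp: braid_class_def braid_rel_def intro: braid_eq.sym)
    from exceptional_braid_eq[OF this] show ?thesis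
      using braid_class_eq braid_eq_words by blast
  qed
  moreover have "w \<in> braid_class 4 w"
    using assms by (auto simp: braid_class_def braid_rel_def intro: braid_eq.refl)
  ultimately show ?thesis
    unfolding exceptional_def by blast
qed

lemma exceptional_hom: "exceptional \<in> hom (braid_group 4) (braid_group 3)"
proof (rule homI)
  let ?f = "map (map_letter (\<lambda>i::nat. if i = 3 then 1 else i))"
  have f: "?f w \<in> braid_words 3" if "w \<in> braid_words 4" for w
    using exceptional_braid_eq[OF braid_eq.refl[OF that]] braid_eq_words by blast
  show "exceptional x \<in> carrier (braid_group 3)" if "x \<in> carrier (braid_group 4)" for x
    using that f by (auto simp: carrier_braid_group exceptional_class)
  show "exceptional (x \<otimes>\<^bsub>braid_group 4\<^esub> y) =
      exceptional x \<otimes>\<^bsub>braid_group 3\<^esub> exceptional y"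
    if "x \<in> carrier (braid_group 4)" "y \<in> carrier (braid_group 4)" for x y
    using that f
    by (auto simp: carrier_braid_group braid_mult_class exceptional_class)
qed

lemma exceptional_gen:
  "exceptional (braid_gen 4 1) = braid_gen 3 1"
  "exceptional (braid_gen 4 2) = braid_gen 3 2"
  "exceptional (braid_gen 4 3) = braid_gen 3 1"
  by (simp_all add: braid_gen_def exceptional_class braid_words_def)

end

theory Submission
  imports Defs Complex_Main
begin

text \<open>Let \<open>\<beta> = \<sigma>\<^sub>1\<sigma>\<^sub>2\<sigma>\<^sub>3\<close>, \<open>\<gamma> = \<beta>\<sigma>\<^sub>1\<close> and \<open>\<zeta> = \<beta>\<^sup>4 = \<gamma>\<^sup>3\<close>, which generates the centre. Modulo the centre, the kernel of
  \<open>B\<^sub>4 \<rightarrow> PSL(2,\<int>)\<close> is the free product \<open>W\<close> of three groups of order 2, generated by the conjugates of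
  \<open>\<beta>\<^sup>2\<close> under the powers of \<open>\<gamma>\<close>; it embeds in \<open>PSL(2,\<int>)\<close>, so its centralizers are commutative. Let
  \<open>a, b, c\<close> be the images of the generators. Their matrices satisfy \<open>A = C\<close>. If \<open>a \<noteq> c\<close>, then
  \<open>u = ac\<^sup>-\<^sup>1\<close> is a nontrivial element of \<open>W\<close> which \<open>(abc)\<^sup>2\<close> inverts. Commutativity of centralizers
  then yields \<open>A \<noteq> B\<close> and the centrality of \<open>(abc)\<^sup>4\<close>, so \<open>(abc)\<^sup>2\<close> is an involution of \<open>W\<close>, hence conjugate
  to \<open>\<beta>\<^sup>2\<close>. The action of \<open>B\<^sub>4\<close> on the plane by affine maps turns \<open>u\<close> into a nonzero
  vector fixed by \<open>A\<close>, so \<open>A\<close> is unipotent and, up to an automorphism of \<open>B\<^sub>4\<close>, the matrices \<open>A, B\<close> are the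
  standard ones. Then \<open>abc = \<beta>\<close> modulo the centre, and the remaining freedom is a word \<open>w \<in> W\<close> with
  \<open>abca = w\<gamma>\<close>. The relation \<open>(abca)\<^sup>3 = (abc)\<^sup>4\<close> and the commutation of \<open>a\<close> with \<open>c\<close> become two equations in the
  free product, which have only two solutions; both come from inner automorphisms.\<close>

section \<open>Groups, braid relations and the type of four-strand braids\<close>

text \<open>Multiplicative notation lets \<open>b4\<close> share the syntax of
  \<open>monoid_mult\<close> with the matrices, affine maps and reals that represent it.\<close>

class mult_group = monoid_mult +
  fixes ginv :: "'a \<Rightarrow> 'a"
  assumes ginv_left [simp]: "ginv a * a = 1"
begin

lemma ginv_left_assoc [simp]: "ginv a * (a * b) = b"
  by (simp flip: mult.assoc)

lemma mult_left_cancel_group: "a * b = a * c \<longleftrightarrow> b = c"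
  by (metis ginv_left_assoc)

lemma ginv_right [simp]: "a * ginv a = 1"
  by (metis ginv_left ginv_left_assoc mult_1_right)

lemma ginv_right_assoc [simp]: "a * (ginv a * b) = b"
  by (simp flip: mult.assoc)

lemma mult_right_cancel_group: "b * a = c * a \<longleftrightarrow> b = c"
  by (metis ginv_right mult.assoc mult_1_right)

lemma ginv_unique: "a * b = 1 \<Longrightarrow> ginv a = b"
  by (metis ginv_left_assoc mult_1_right)

lemma ginv_ginv [simp]: "ginv (ginv a) = a"
  by (simp add: ginv_unique)

lemma ginv_one [simp]: "ginv 1 = 1"
  by (simp add: ginv_unique)

lemma ginv_mult [simp]: "ginv (a * b) = ginv b * ginv a"
  by (rule ginv_unique) (simp add: mult.assoc)

lemma ginv_commute:
  assumes "a * b = b * a" shows "a * ginv b = ginv b * a"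
proof -
  have "ginv b * (a * b) * ginv b = ginv b * (b * a) * ginv b"
    by (simp only: assms)
  then show ?thesis by (simp add: mult.assoc)
qed

end

text \<open>Stated in a monoid so that it covers triples of braids as well as triples of
  matrices.\<close>

locale braid_triple =
  fixes a b c :: "'a :: monoid_mult"
  assumes aba: "a * b * a = b * a * b" and bcb: "b * c * b = c * b * c" and ac: "a * c = c * a"
begin

lemma aba': "a * (b * (a * x)) = b * (a * (b * x))"
  using arg_cong[OF aba, of "\<lambda>y. y * x"] by (simp only: mult.assoc)

lemma bcb': "c * (b * (c * x)) = b * (c * (b * x))"
  using arg_cong[OF bcb, of "\<lambda>y. y * x"] by (simp only: mult.assoc)

lemma ac': "c * (a * x) = a * (c * x)"
  using arg_cong[OF ac, of "\<lambda>y. y * x"] by (simp only: mult.assoc)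

text \<open>For the standard generators, \<open>bet\<close> and \<open>gam\<close> are a fourth and
  a third root of the full twist.\<close>

definition bet :: 'a where "bet = a * (b * c)"
definition gam :: 'a where "gam = bet * a"

lemma bet_a: "bet * a = b * bet"
proof -
  have "bet * a = a * (b * (a * c))"
    by (simp only: bet_def mult.assoc ac)
  then show ?thesis by (simp only: bet_def aba')
qed

lemma bet_b: "bet * b = c * bet"
proof -
  have "bet * b = a * (b * c * b)" by (simp only: bet_def mult.assoc)
  also have "\<dots> = a * (c * b * c)" by (simp only: bcb)
  also have "\<dots> = c * bet" by (simp only: bet_def mult.assoc ac')
  finally show ?thesis .
qed

lemma bet_a': "bet * (a * x) = b * (bet * x)"
  using arg_cong[OF bet_a, of "\<lambda>y. y * x"] by (simp only: mult.assoc)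

lemma bet_b': "bet * (b * x) = c * (bet * x)"
  using arg_cong[OF bet_b, of "\<lambda>y. y * x"] by (simp only: mult.assoc)

lemma bcbetc: "b * (c * (bet * c)) = bet * bet"
proof -
  have "b * (c * (bet * c)) = b * (a * (c * (b * (c * c))))"
    by (simp only: bet_def mult.assoc ac')
  also have "\<dots> = b * (a * (b * (c * (b * c))))" by (simp only: bcb')
  also have "\<dots> = a * (b * (a * (c * (b * c))))" by (simp only: aba')
  also have "\<dots> = bet * bet" by (simp only: bet_def mult.assoc ac')
  finally show ?thesis .
qed

lemma bcbetc': "b * (c * (bet * (c * x))) = bet * (bet * x)"
  using arg_cong[OF bcbetc, of "\<lambda>y. y * x"] by (simp only: mult.assoc)

lemma bet2_a: "bet * (bet * a) = c * (bet * bet)"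
  by (simp only: bet_a bet_b')

lemma bet2_c: "bet * (bet * c) = a * (bet * bet)"
proof -
  have "bet * (bet * c) = a * (b * (c * (bet * c)))"
    by (subst bet_def) (simp only: mult.assoc)
  then show ?thesis by (simp only: bcbetc)
qed

lemma bet2_c': "bet * (bet * (c * x)) = a * (bet * (bet * x))"
  using arg_cong[OF bet2_c, of "\<lambda>y. y * x"] by (simp only: mult.assoc)

lemma bet_pow4: "bet ^ 4 = bet * (bet * (bet * bet))"
  by (simp add: numeral_eq_Suc)

text \<open>These rules carry \<open>bet\<close> to the right. One copy passes \<open>a\<close> and
  \<open>b\<close>; two copies together pass \<open>c\<close>, which becomes
  \<open>a\<close>.\<close>

lemmas bet_push = bet_a bet_b bet_a' bet_b' bet2_c bet2_c'

lemma bet4_a: "bet ^ 4 * a = a * bet ^ 4"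
  by (simp only: bet_pow4 mult.assoc bet_push)

lemma bet4_c: "bet ^ 4 * c = c * bet ^ 4"
  by (simp only: bet_pow4 mult.assoc bet_push)

lemma gam3: "gam ^ 3 = bet ^ 4"
  by (simp add: gam_def bet_pow4 numeral_eq_Suc mult.assoc bet_push bcbetc')

text \<open>This commutation of \<open>bet * bet\<close> with \<open>gam * bet * gam\<close>
  determines how \<open>\<beta>\<close> conjugates the involutions in \<open>bet_eps1\<close> and
  gives one of the two equations solved in \<open>gam_standard\<close>.\<close>

lemma bet2_gam_bet_gam: "bet * (bet * (gam * (bet * gam))) = gam * (bet * (gam * (bet * bet)))"
  by (simp only: gam_def mult.assoc bet_push ac ac')

lemma bet4_b:
  assumes "\<And>x y. bet * x = bet * y \<Longrightarrow> x = y"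
  shows "bet ^ 4 * b = b * bet ^ 4"
proof (rule assms)
  have "bet * (b * bet ^ 4) = c * (bet * bet ^ 4)" by (simp only: bet_b')
  also have "bet * bet ^ 4 = bet ^ 4 * bet" by (simp only: power_commutes)
  also have "c * (bet ^ 4 * bet) = bet ^ 4 * (c * bet)"
    by (simp only: mult.assoc[symmetric] bet4_c)
  finally show "bet * (bet ^ 4 * b) = bet * (b * bet ^ 4)"
    by (simp only: bet_b[symmetric] mult.assoc[symmetric] power_commutes)
qed

end

section \<open>The presentation of the four-strand group and its universal property\<close>

definition braid_respecting :: "nat \<Rightarrow> (nat letter \<Rightarrow> 'm :: monoid_mult) \<Rightarrow> bool" where
  "braid_respecting n f \<longleftrightarrow>
    (\<forall>i\<in>{1..<n}. f (Gen i) * f (Inv i) = 1 \<and> f (Inv i) * f (Gen i) = 1) \<and>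
    (\<forall>i\<in>{1..<n}. \<forall>j\<in>{1..<n}. i + 1 < j \<longrightarrow> f (Gen i) * f (Gen j) = f (Gen j) * f (Gen i)) \<and>
    (\<forall>i\<in>{1..<n}. i + 1 \<in> {1..<n} \<longrightarrow>
      f (Gen i) * f (Gen (i + 1)) * f (Gen i) = f (Gen (i + 1)) * f (Gen i) * f (Gen (i + 1)))"

definition ev :: "('a \<Rightarrow> 'm :: monoid_mult) \<Rightarrow> 'a list \<Rightarrow> 'm" where
  "ev f w = prod_list (map f w)"

lemma ev_simps [simp]:
  "ev f [] = 1" "ev f (a # w) = f a * ev f w" "ev f (u @ v) = ev f u * ev f v"
  by (simp_all add: ev_def)

lemma ev_braid_eq:
  assumes "braid_respecting n f" "braid_eq n u v"
  shows "ev f u = ev f v"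
  using assms(2)
proof (induction rule: braid_eq.induct)
  case (cancel a)
  then show ?case
    using assms(1) by (cases a) (auto simp: braid_respecting_def braid_words_def)
next
  case (commute i j)
  then have "f (Gen i) * f (Gen j) = f (Gen j) * f (Gen i)"
    using assms(1) unfolding braid_respecting_def by blast
  then show ?case by simp
next
  case (braid i)
  then have "f (Gen i) * f (Gen (i + 1)) * f (Gen i) = f (Gen (i + 1)) * f (Gen i) * f (Gen (i + 1))"
    using assms(1) unfolding braid_respecting_def by blast
  then show ?case by (simp add: mult.assoc)
qed auto

\<comment> \<open>The quotient is partial because \<open>braid_eq 4\<close> is reflexive only on
  words in the generators 1 to 3. \<open>b4_class\<close> identifies this type with the carrier of
  \<open>braid_group 4\<close>.\<close>
quotient_type b4 = braid_word / partial: "braid_eq 4"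
proof (rule part_equivpI)
  show "\<exists>x. braid_eq 4 x x" using braid_eq.refl[of "[]"] by auto
  show "symp (braid_eq 4)" by (auto intro: sympI braid_eq.sym)
  show "transp (braid_eq 4)" by (auto intro: transpI braid_eq.trans)
qed

text \<open>Makes \<open>ginv\<close> well defined. The argument is uniqueness of inverses: u^-1 ~
  u^-1 v v^-1 ~ u^-1 u v^-1 ~ v^-1.\<close>

lemma braid_eq_inverse:
  "braid_eq n u v \<Longrightarrow> braid_eq n (rev (map inv_letter u)) (rev (map inv_letter v))"
proof -
  assume uv: "braid_eq n u v"
  let ?i = "\<lambda>w. rev (map inv_letter w)"
  have w: "u \<in> braid_words n" "v \<in> braid_words n" using braid_eq_words[OF uv] by auto
  then have iw: "?i u \<in> braid_words n" "?i v \<in> braid_words n"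
    by (auto simp: braid_words_def)
  have "?i (?i v) = v" by (simp add: rev_map o_def)
  then have r: "braid_eq n (v @ ?i v) []" using braid_eq_left_inverse[OF iw(2)] by simp
  have "braid_eq n (?i u @ []) (?i u @ (v @ ?i v))"
    by (intro braid_eq.append braid_eq.refl iw braid_eq.sym[OF r])
  moreover have "braid_eq n (?i u @ (v @ ?i v)) (?i u @ (u @ ?i v))"
    by (intro braid_eq.append braid_eq.refl iw braid_eq.sym[OF uv])
  moreover have "braid_eq n ((?i u @ u) @ ?i v) ([] @ ?i v)"
    by (intro braid_eq.append braid_eq.refl iw braid_eq_left_inverse w)
  ultimately show ?thesis
    by (auto intro: braid_eq.trans)
qed

instantiation b4 :: mult_group
begin

lift_definition one_b4 :: b4 is "[]" by (simp add: braid_eq.refl)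
lift_definition times_b4 :: "b4 \<Rightarrow> b4 \<Rightarrow> b4" is "(@)" by (rule braid_eq.append)
lift_definition ginv_b4 :: "b4 \<Rightarrow> b4" is "\<lambda>w. rev (map inv_letter w)"
  by (rule braid_eq_inverse)

instance
proof
  fix a b c :: b4
  show "a * b * c = a * (b * c)" "1 * a = a" "a * 1 = a"
    by (transfer, use braid_eq_words in \<open>auto intro!: braid_eq.refl\<close>)+
  show "ginv a * a = 1"
    by transfer (use braid_eq_words braid_eq_left_inverse in blast)
qed

end

lift_definition s1 :: b4 is "[Gen 1]" by (auto intro!: braid_eq.refl simp: braid_words_def)
lift_definition s2 :: b4 is "[Gen 2]" by (auto intro!: braid_eq.refl simp: braid_words_def)
lift_definition s3 :: b4 is "[Gen 3]" by (auto intro!: braid_eq.refl simp: braid_words_def)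

lift_definition b4_class :: "b4 \<Rightarrow> braid" is "braid_class 4"
  using braid_class_eq braid_eq_words by blast

lemma braid_eq_self [simp]: "braid_eq n w w \<longleftrightarrow> w \<in> braid_words n"
  using braid_eq_words braid_eq.refl by blast

lemma b4_cases: obtains w where "w \<in> braid_words 4" "x = abs_b4 w"
proof
  show "rep_b4 x \<in> braid_words 4"
    using Quotient_rep_reflp[OF Quotient_b4] by (simp only: braid_eq_self)
  show "x = abs_b4 (rep_b4 x)"
    by (simp only: Quotient_abs_rep[OF Quotient_b4])
qed

lemma abs_b4_eq:
  assumes "u \<in> braid_words 4" "v \<in> braid_words 4"
  shows "abs_b4 u = abs_b4 v \<longleftrightarrow> braid_eq 4 u v"
  using Quotient_rel[OF Quotient_b4, of u v] assms by simp

lemma abs_b4_mult: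
  "u \<in> braid_words 4 \<Longrightarrow> v \<in> braid_words 4 \<Longrightarrow> abs_b4 u * abs_b4 v = abs_b4 (u @ v)"
  by (simp add: times_b4.abs_eq)

lemma b4_class_abs: "w \<in> braid_words 4 \<Longrightarrow> b4_class (abs_b4 w) = braid_class 4 w"
  by (simp add: b4_class.abs_eq)

lemma b4_class_inj: "b4_class x = b4_class y \<longleftrightarrow> x = y"
  by (cases x rule: b4_cases, cases y rule: b4_cases)
    (simp add: b4_class_abs abs_b4_eq braid_class_eq)

lemma b4_class_carrier: "b4_class x \<in> carrier (braid_group 4)"
  by (cases x rule: b4_cases) (auto simp: b4_class_abs carrier_braid_group)

lemma b4_class_surj: "X \<in> carrier (braid_group 4) \<Longrightarrow> \<exists>x. X = b4_class x"
  by (auto simp: carrier_braid_group simp flip: b4_class_abs)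

lemma b4_class_mult: "b4_class (x * y) = b4_class x \<otimes>\<^bsub>braid_group 4\<^esub> b4_class y"
  by (cases x rule: b4_cases, cases y rule: b4_cases)
    (simp add: abs_b4_mult b4_class_abs braid_mult_class)

lemma gen_words [simp]: "[Gen i] \<in> braid_words n \<longleftrightarrow> i \<in> {1..<n}" "[Inv i] \<in> braid_words n \<longleftrightarrow> i \<in> {1..<n}"
  by (auto simp: braid_words_def)

lemma b4_class_gens:
  "b4_class s1 = braid_gen 4 1" "b4_class s2 = braid_gen 4 2" "b4_class s3 = braid_gen 4 3"
  by (simp_all add: s1_def s2_def s3_def b4_class_abs braid_gen_def)

lemma braid_relations: "s1 * s2 * s1 = s2 * s1 * s2" "s2 * s3 * s2 = s3 * s2 * s3" "s1 * s3 = s3 * s1"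
proof -
  have w: "u \<in> braid_words 4" if "u \<in> lists (Gen ` {1, 2, 3})" for u
    using that by (fastforce simp: braid_words_def)
  have n: "(1::nat) + 1 = 2" "(2::nat) + 1 = 3" by simp_all
  have "braid_eq 4 [Gen 1, Gen 2, Gen 1] [Gen 2, Gen 1, Gen 2]"
    "braid_eq 4 [Gen 2, Gen 3, Gen 2] [Gen 3, Gen 2, Gen 3]"
    by (rule braid_eq.braid[of 1 4, unfolded n] braid_eq.braid[of 2 4, unfolded n], simp, simp)+
  then show "s1 * s2 * s1 = s2 * s1 * s2" "s2 * s3 * s2 = s3 * s2 * s3"
    unfolding s1_def s2_def s3_def by (simp_all add: abs_b4_mult w abs_b4_eq del: One_nat_def)
  show "s1 * s3 = s3 * s1"
    unfolding s1_def s3_def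
    using braid_eq.commute[of 1 4 3] by (simp add: abs_b4_mult w abs_b4_eq)
qed

lemma b4_gens: "abs_b4 [Gen 1] = s1" "abs_b4 [Gen 2] = s2" "abs_b4 [Gen 3] = s3"
  "abs_b4 [Inv 1] = ginv s1" "abs_b4 [Inv 2] = ginv s2" "abs_b4 [Inv 3] = ginv s3"
  by (simp_all add: s1_def s2_def s3_def ginv_b4.abs_eq)

lemma b4_induct [case_names one s1 s2 s3 s1' s2' s3']:
  fixes P :: "b4 \<Rightarrow> bool"
  assumes "P 1" "\<And>x. P x \<Longrightarrow> P (s1 * x)" "\<And>x. P x \<Longrightarrow> P (s2 * x)" "\<And>x. P x \<Longrightarrow> P (s3 * x)"
    "\<And>x. P x \<Longrightarrow> P (ginv s1 * x)" "\<And>x. P x \<Longrightarrow> P (ginv s2 * x)" "\<And>x. P x \<Longrightarrow> P (ginv s3 * x)"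
  shows "P x"
proof -
  have "P (abs_b4 w)" if "w \<in> braid_words 4" for w
    using that
  proof (induction w)
    case Nil
    then show ?case using assms(1) by (simp add: one_b4_def)
  next
    case (Cons a w)
    then have w: "w \<in> braid_words 4" and a: "[a] \<in> braid_words 4"
      by (auto simp: braid_words_def)
    have eq: "abs_b4 (a # w) = abs_b4 [a] * abs_b4 w"
      using w a by (simp add: abs_b4_mult)
    have "abs_b4 [a] \<in> {s1, s2, s3, ginv s1, ginv s2, ginv s3}"
    proof (cases a)
      case (Gen i)
      then have "i = 1 \<or> i = 2 \<or> i = 3" using a by auto
      then show ?thesis unfolding Gen using b4_gens by (elim disjE) simp_all
    next
      case (Inv i)
      then have "i = 1 \<or> i = 2 \<or> i = 3" using a by auto
      then show ?thesis unfolding Inv using b4_gens by (elim disjE) simp_all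
    qed
    then show ?case
      unfolding eq by (elim insertE emptyE) (simp_all only: assms(2-) Cons.IH[OF w])
  qed
  then show ?thesis by (cases x rule: b4_cases) simp
qed

text \<open>The universal property of the presentation. Inverses of the images are supplied
  explicitly because the target is only a monoid.\<close>

lemma b4_hom_exists:
  fixes a b c :: "'m :: monoid_mult"
  assumes "a * b * a = b * a * b" "b * c * b = c * b * c" "a * c = c * a"
    and inv: "a * a' = 1" "a' * a = 1" "b * b' = 1" "b' * b = 1" "c * c' = 1" "c' * c = 1"
  obtains h where "h 1 = 1" "\<And>x y. h (x * y) = h x * h y" "h s1 = a" "h s2 = b" "h s3 = c"
proof -
  define p where "p i = (if i = 1 then a else if i = 2 then b else c)" for i :: nat
  define q where "q i = (if i = 1 then a' else if i = 2 then b' else c')" for i :: nat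
  define f where "f l = (case l of Gen i \<Rightarrow> p i | Inv i \<Rightarrow> q i)" for l :: "nat letter"
  have i3: "i \<in> {1..<4} \<Longrightarrow> i = 1 \<or> i = 2 \<or> i = 3" for i :: nat by auto
  have r: "braid_respecting 4 f"
    unfolding braid_respecting_def
  proof (intro conjI ballI impI)
    fix i :: nat assume i: "i \<in> {1..<4}"
    show "f (Gen i) * f (Inv i) = 1" "f (Inv i) * f (Gen i) = 1"
      using i3[OF i] inv by (auto simp: f_def p_def q_def)
    show "f (Gen i) * f (Gen (i + 1)) * f (Gen i) = f (Gen (i + 1)) * f (Gen i) * f (Gen (i + 1))"
      if i1: "i + 1 \<in> {1..<4}"
    proof -
      consider "i = 1" "i + 1 = 2" | "i = 2" "i + 1 = 3" using i3[OF i] i1 by force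
      then show ?thesis
      proof cases
        case 1
        have "f (Gen 1) = a" "f (Gen 2) = b" by (simp_all add: f_def p_def)
        then show ?thesis unfolding 1(2) unfolding 1(1) using assms(1) by (simp only:)
      next
        case 2
        have "f (Gen 2) = b" "f (Gen 3) = c" by (simp_all add: f_def p_def)
        then show ?thesis unfolding 2(2) unfolding 2(1) using assms(2) by (simp only:)
      qed
    qed
    show "f (Gen i) * f (Gen j) = f (Gen j) * f (Gen i)" if "j \<in> {1..<4}" "i + 1 < j" for j
    proof -
      have "i = 1" "j = 3" using i3[OF i] i3[OF that(1)] that(2) by auto
      then show ?thesis using assms(3) by (simp add: f_def p_def)
    qed
  qed
  define h where "h x = ev f (rep_b4 x)" for x
  have hw: "h (abs_b4 w) = ev f w" if "w \<in> braid_words 4" for w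
  proof -
    have "braid_eq 4 (rep_b4 (abs_b4 w)) w"
      using that by (intro Quotient_rep_abs[OF Quotient_b4]) simp
    then show ?thesis unfolding h_def by (rule ev_braid_eq[OF r])
  qed
  show ?thesis
  proof (rule that)
    show "h 1 = 1" using hw[of "[]"] by (simp add: one_b4_def)
    show "h (x * y) = h x * h y" for x y
      by (cases x rule: b4_cases, cases y rule: b4_cases) (simp add: abs_b4_mult hw)
    show "h s1 = a" "h s2 = b" "h s3 = c"
      using hw[of "[Gen 1]"] hw[of "[Gen 2]"] hw[of "[Gen 3]"]
      by (simp_all add: s1_def s2_def s3_def f_def p_def)
  qed
qed

section \<open>Two-by-two integer matrices and representations\<close>

datatype mat = Mat int int int int

instantiation mat :: ring_1
begin

definition "0 = Mat 0 0 0 0"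
definition "1 = Mat 1 0 0 1"
fun plus_mat where "Mat a b c d + Mat e f g h = Mat (a + e) (b + f) (c + g) (d + h)"
fun minus_mat where "Mat a b c d - Mat e f g h = Mat (a - e) (b - f) (c - g) (d - h)"
fun uminus_mat where "- Mat a b c d = Mat (- a) (- b) (- c) (- d)"
fun times_mat where
  "Mat a b c d * Mat e f g h = Mat (a * e + b * g) (a * f + b * h) (c * e + d * g) (c * f + d * h)"

instance
proof
  fix x y z :: mat
  show "x + y + z = x + (y + z)" "x + y = y + x" "0 + x = x" "- x + x = 0" "x - y = x + - y"
    "x * y * z = x * (y * z)" "1 * x = x" "x * 1 = x" "(x + y) * z = x * z + y * z"
    "x * (y + z) = x * y + x * z" "(0 :: mat) \<noteq> 1"
    by (cases x; cases y; cases z; simp add: zero_mat_def one_mat_def algebra_simps)+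
qed

end

fun tr :: "mat \<Rightarrow> int" where "tr (Mat a b c d) = a + d"
fun det :: "mat \<Rightarrow> int" where "det (Mat a b c d) = a * d - b * c"
fun adj :: "mat \<Rightarrow> mat" where "adj (Mat a b c d) = Mat d (- b) (- c) a"

lemma det_mult [simp]: "det (x * y) = det x * det y"
  by (cases x; cases y) (simp add: algebra_simps)

lemma det_one [simp]: "det 1 = 1" and det_uminus [simp]: "det (- x) = det x"
  by (simp add: one_mat_def) (cases x; simp)

lemma tr_mult_commute: "tr (x * y) = tr (y * x)"
  by (cases x; cases y) (simp add: algebra_simps)

lemma adj_left: "det x = 1 \<Longrightarrow> adj x * x = 1" and adj_right: "det x = 1 \<Longrightarrow> x * adj x = 1"
  by (cases x; simp add: one_mat_def algebra_simps)+

lemma det_adj [simp]: "det (adj x) = det x"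
  by (cases x) simp

lemma mat_left_cancel: "det x = 1 \<Longrightarrow> x * y = x * z \<longleftrightarrow> y = z"
  by (metis adj_left mult.assoc mult_1_left)

lemma mat_right_cancel: "det x = 1 \<Longrightarrow> y * x = z * x \<longleftrightarrow> y = z"
  by (metis adj_right mult.assoc mult_1_right)

text \<open>Adding the upper left entry of \<open>x * x = 1\<close> to the determinant equation
  gives \<open>a * (a + d) = 2\<close>. So the trace is nonzero, and the off-diagonal entries
  vanish.\<close>

lemma mat_square_one:
  assumes "x * x = 1" "det x = 1" shows "x = 1 \<or> x = - 1"
proof (cases x)
  case (Mat a b c d)
  have e: "a * a + b * c = 1" "b * (a + d) = 0" "c * (a + d) = 0" "a * d - b * c = 1"
    using assms Mat by (auto simp: one_mat_def algebra_simps)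
  then have "a * (a + d) = 2" by (simp add: algebra_simps)
  then have "a + d \<noteq> 0" by auto
  then have bc: "b = 0" "c = 0" using e by auto
  then have "a * a = 1" "a * d = 1" using e by auto
  then show ?thesis using Mat bc by (auto simp: one_mat_def zmult_eq_1_iff)
qed

text \<open>The braid relation makes \<open>y\<close> the conjugate of \<open>x\<close> by
  \<open>x * y\<close>.\<close>

lemma mat_braid_trace:
  assumes "det x = 1" "det y = 1" "x * y * x = y * x * y" shows "tr x = tr y"
proof -
  have "x * y * x * adj (x * y) = y * (x * y * adj (x * y))"
    using assms(3) by (simp add: mult.assoc)
  then have "y = x * y * x * adj (x * y)"
    using adj_right[of "x * y"] assms by simp
  then have "tr y = tr (adj (x * y) * (x * y * x))" by (metis tr_mult_commute)
  also have "adj (x * y) * (x * y * x) = (adj (x * y) * (x * y)) * x"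
    by (simp only: mult.assoc)
  also have "\<dots> = x"
    using adj_left[of "x * y"] assms(1,2) by simp
  finally show ?thesis by simp
qed

text \<open>As the traces of \<open>x\<close> and \<open>y\<close> agree, Cayley-Hamilton turns the
  braid relation into the vanishing of \<open>x - y\<close> times the scalar
  \<open>tr (x * y) - 1\<close>.\<close>

lemma mat_braid:
  assumes "det x = 1" "det y = 1" "x * y * x = y * x * y" shows "x = y \<or> tr (x * y) = 1"
proof (cases x; cases y)
  fix a b c d e f g h
  assume m: "x = Mat a b c d" "y = Mat e f g h"
  let ?t = "tr (x * y)"
  have t: "a + d = e + h" using mat_braid_trace[OF assms] m by simp
  \<comment> \<open>Entrywise form of u v u = tr(u v) u - det(u) adj(v), a consequence of
    Cayley-Hamilton for \<open>u * v\<close>.\<close>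
  have 1: "u * v * u = Mat (s * p + - l * z) (s * q + l * w) (s * r + l * k) (s * o' + - l * j)"
    if "u = Mat p q r o'" "v = Mat j w k z" "s = tr (u * v)" "l = det u" for u v p q r o' j w k z s l
    unfolding that by (simp add: algebra_simps)
  have "Mat (?t * a - h) (?t * b + f) (?t * c + g) (?t * d - e)
      = Mat (?t * e - d) (?t * f + b) (?t * g + c) (?t * h - a)"
    using 1[OF m HOL.refl HOL.refl] 1[OF m(2,1) HOL.refl HOL.refl] assms tr_mult_commute[of y x] by simp
  then have "(?t - 1) * (a - e) = 0" "(?t - 1) * (b - f) = 0" "(?t - 1) * (c - g) = 0"
    "(?t - 1) * (d - h) = 0"
    using t by (auto simp: algebra_simps)
  then show ?thesis using m by auto
qed

lemma mat_braid_commute: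
  assumes "det x = 1" "det y = 1" "x * y * x = y * x * y" "x * y = y * x" shows "x = y"
proof -
  have "(x * y) * x = (x * y) * y" using assms by (metis mult.assoc)
  then show ?thesis using mat_left_cancel[of "x * y"] assms by simp
qed

text \<open>Commuting matrices have parallel traceless parts: these are the vanishing minors of
  \<open>(b, c, a - d)\<close> and \<open>(q, r, p - t)\<close>.\<close>

lemma mat_commute_entries:
  assumes "Mat a b c d * Mat p q r t = Mat p q r t * Mat a b c d"
  shows "b * r = q * c" "b * (p - t) = q * (a - d)" "c * (p - t) = r * (a - d)"
proof -
  have e: "a * p + b * r = p * a + q * c" "a * q + b * t = p * b + q * d" "c * p + d * r = r * a + t * c"
    using assms by simp_all
  show "b * r = q * c" "b * (p - t) = q * (a - d)" "c * (p - t) = r * (a - d)"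
    using e(1) apply (simp only: mult.commute)
    using e(2) apply (simp add: right_diff_distrib mult.commute)
    using e(3) apply (simp add: right_diff_distrib mult.commute)
    done
qed

text \<open>If \<open>y\<close> differs from both neighbours, the traceless parts of
  \<open>x\<close> and \<open>z\<close> are parallel and have the same nonzero trace pairing with
  that of \<open>y\<close>, so they agree. If \<open>y\<close> equals a neighbour, the outer two
  commute and satisfy the braid relation, so all three coincide.\<close>

lemma mat_braid_triple:
  assumes "braid_triple x y z" "det x = 1" "det y = 1" "det z = 1"
  shows "x = z" "x = y \<or> tr (x * y) = 1"
proof -
  interpret braid_triple x y z by fact
  show xy: "x = y \<or> tr (x * y) = 1" using mat_braid aba assms by blast
  have yz: "y = z \<or> tr (y * z) = 1" using mat_braid bcb assms by blast
  show "x = z"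
  proof (cases "x = y \<or> y = z")
    case True
    then show ?thesis using mat_braid_commute[of x y] mat_braid_commute[of y z] aba bcb ac assms by metis
  next
    case False
    obtain a b c d where x: "x = Mat a b c d" by (cases x)
    obtain e f g h where y: "y = Mat e f g h" by (cases y)
    obtain p q r t where z: "z = Mat p q r t" by (cases z)
    have tr: "a + d = e + h" "p + t = e + h"
      using mat_braid_trace[of x y] mat_braid_trace[of y z] aba bcb assms x y z by auto
    have t1: "a * e + b * g + c * f + d * h = 1" "p * e + q * g + r * f + t * h = 1"
      using False xy yz x y z by (auto simp: algebra_simps)
    define s where "s = e + h"
    \<comment> \<open>Twice the trace pairing with the traceless part of \<open>y\<close>. On the
      traceless parts of \<open>x\<close> and \<open>z\<close> its value is twice the trace of the
      product with \<open>y\<close> minus \<open>s * s\<close>, that is \<open>2 - s * s\<close>;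
      this is nonzero because 2 is not a square.\<close>
    define l where "l k1 k2 k3 = (e - h) * k1 + 2 * g * k2 + 2 * f * k3" for k1 k2 k3
    have d: "d = s - a" "t = s - p" "h = s - e" using tr by (auto simp: s_def)
    have l1: "l (a - d) b c = 2 - s * s"
      using t1(1) unfolding l_def d by algebra
    have l2: "l (p - t) q r = 2 - s * s"
      using t1(2) unfolding l_def d by algebra
    have co: "b * r = q * c" "b * (p - t) = q * (a - d)" "c * (p - t) = r * (a - d)"
      using mat_commute_entries[OF ac[unfolded x z]] by blast+
    have par3: "l m q r * k = l k b c * m \<and> l m q r * b = l k b c * q \<and> l m q r * c = l k b c * r"
      if "b * r = q * c" "b * m = q * k" "c * m = r * k" for k m
    proof -
      have "(e - h) * m * k + 2 * g * (q * k) + 2 * f * (r * k) = (e - h) * k * m + 2 * g * (b * m) + 2 * f * (c * m)"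
        "(e - h) * (b * m) + 2 * g * q * b + 2 * f * (b * r) = (e - h) * (q * k) + 2 * g * b * q + 2 * f * (q * c)"
        "(e - h) * (c * m) + 2 * g * (q * c) + 2 * f * r * c = (e - h) * (r * k) + 2 * g * (b * r) + 2 * f * c * r"
        by (simp_all add: that)
      then show ?thesis unfolding l_def by (simp add: algebra_simps)
    qed
    have "l (p - t) q r * (a - d) = l (a - d) b c * (p - t)"
      "l (p - t) q r * b = l (a - d) b c * q" "l (p - t) q r * c = l (a - d) b c * r"
      using par3[OF co] by blast+
    then have "(2 - s * s) * (a - d) = (2 - s * s) * (p - t)"
      "(2 - s * s) * b = (2 - s * s) * q" "(2 - s * s) * c = (2 - s * s) * r"
      unfolding l1 l2 by blast+
    moreover have "2 - s * s \<noteq> 0"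
    proof
      assume "2 - s * s = 0"
      then have s2: "s * s = 2" by simp
      then have "even s" by (metis even_mult_iff even_numeral)
      then obtain k where "s = 2 * k" by blast
      then have "2 * (k * k) = 1" using s2 by simp
      then show False by presburger
    qed
    ultimately have "a - d = p - t" "b = q" "c = r" by (simp_all only: mult_cancel_left) blast+
    then show ?thesis using d x z by auto
  qed
qed

text \<open>The determinant excludes every scalar matrix \<open>n\<close>, so its traceless part is
  nonzero; those of \<open>x\<close> and \<open>y\<close> are parallel to it and hence to each
  other.\<close>

lemma mat_commutant:
  fixes n x y :: mat
  assumes "x * n = n * x" "y * n = n * y" "n \<noteq> 1" "n \<noteq> - 1" "det n = 1"
  shows "x * y = y * x"
proof -
  obtain a b c d where n: "n = Mat a b c d" by (cases n)
  obtain e f g h where x: "x = Mat e f g h" by (cases x)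
  obtain p q r t where y: "y = Mat p q r t" by (cases y)
  have k: "\<not> (b = 0 \<and> c = 0 \<and> a = d)"
  proof
    assume "b = 0 \<and> c = 0 \<and> a = d"
    then show False using n assms by (auto simp: one_mat_def zmult_eq_1_iff)
  qed
  note cx = mat_commute_entries[OF assms(1)[unfolded x n, symmetric]]
  note cy = mat_commute_entries[OF assms(2)[unfolded y n, symmetric]]
  have par: "f * r = q * g \<and> f * y = q * x \<and> g * y = r * x"
    if cross: "b * g = f * c" "b * x = f * z" "c * x = g * z" "b * r = q * c" "b * y = q * z" "c * y = r * z"
      "\<not> (b = 0 \<and> c = 0 \<and> z = 0)" for x y z
  proof -
    consider "b \<noteq> 0" | "c \<noteq> 0" | "z \<noteq> 0" using cross(7) by auto
    then show ?thesis
    proof cases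
      case 1
      have "b * b * (f * r) = b * b * (q * g)" "b * b * (f * y) = b * b * (q * x)"
        "b * b * (g * y) = b * b * (r * x)" using cross(1-6) by algebra+
      then show ?thesis using 1 by simp
    next
      case 2
      have "c * c * (f * r) = c * c * (q * g)" "c * c * (f * y) = c * c * (q * x)"
        "c * c * (g * y) = c * c * (r * x)" using cross(1-6) by algebra+
      then show ?thesis using 2 by simp
    next
      case 3
      have "z * z * (f * r) = z * z * (q * g)" "z * z * (f * y) = z * z * (q * x)"
        "z * z * (g * y) = z * z * (r * x)" using cross(1-6) by algebra+
      then show ?thesis using 3 by simp
    qed
  qed
  have "f * r = q * g \<and> f * (p - t) = q * (e - h) \<and> g * (p - t) = r * (e - h)"
    using par[OF cx cy] k by auto
  then show ?thesis unfolding x y by (auto simp: algebra_simps)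
qed

section \<open>The affine representation, the exponent sum and the mirror automorphism\<close>

datatype aff = Aff (lin: mat) (tx: int) (ty: int)

fun mat_x :: "mat \<Rightarrow> int \<Rightarrow> int \<Rightarrow> int" where "mat_x (Mat a b c d) p q = a * p + b * q"
fun mat_y :: "mat \<Rightarrow> int \<Rightarrow> int \<Rightarrow> int" where "mat_y (Mat a b c d) p q = c * p + d * q"

instantiation aff :: monoid_mult
begin

definition "1 = Aff 1 0 0"
fun times_aff where
  "Aff x p q * Aff y r s = Aff (x * y) (mat_x x r s + p) (mat_y x r s + q)"

instance
proof
  fix x y z :: aff
  show "x * y * z = x * (y * z)"
  proof (cases x; cases y; cases z)
    fix a b c p q r s t u
    assume "x = Aff a p q" "y = Aff b r s" "z = Aff c t u"
    then show ?thesis by (cases a; cases b; cases c) (simp add: algebra_simps)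
  qed
  show "1 * x = x" "x * 1 = x"
    by (cases x; cases "lin x"; simp add: one_aff_def one_mat_def)+
qed

end

lemma lin_mult [simp]: "lin (x * y) = lin x * lin y" and lin_one [simp]: "lin 1 = 1"
  by (cases x; cases y; simp) (simp add: one_aff_def)

definition is_hom :: "(b4 \<Rightarrow> 'm :: monoid_mult) \<Rightarrow> bool" where
  "is_hom h \<longleftrightarrow> h 1 = 1 \<and> (\<forall>x y. h (x * y) = h x * h y)"

lemma is_homD: "is_hom h \<Longrightarrow> h 1 = 1" "is_hom h \<Longrightarrow> h (x * y) = h x * h y"
  "is_hom h \<Longrightarrow> h (x ^ n) = h x ^ n" "is_hom h \<Longrightarrow> h (ginv x) * h x = 1" "is_hom h \<Longrightarrow> h x * h (ginv x) = 1"
proof -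
  assume h: "is_hom h"
  then show m: "h 1 = 1" "h (x * y) = h x * h y" for x y by (auto simp: is_hom_def)
  show "h (x ^ n) = h x ^ n" by (induction n) (simp_all add: m)
  show "h (ginv x) * h x = 1" "h x * h (ginv x) = 1" by (simp_all flip: m)
qed

definition Amat :: mat where "Amat = Mat 1 1 0 1"
definition Bmat :: mat where "Bmat = Mat 1 0 (- 1) 1"

text \<open>The third generator acts as the conjugate of the first one by a translation; the kernel
  of \<open>B\<^sub>4 \<rightarrow> B\<^sub>3\<close>, on which the linear part is trivial, acts on \<open>\<int>\<^sup>2\<close> by nontrivial translations.\<close>

definition aff_rep :: "b4 \<Rightarrow> aff" where
  "aff_rep = (SOME h. is_hom h \<and> h s1 = Aff Amat 0 0 \<and> h s2 = Aff Bmat 0 0 \<and> h s3 = Aff Amat 1 0)"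

lemma aff_rep: "is_hom aff_rep" "aff_rep s1 = Aff Amat 0 0" "aff_rep s2 = Aff Bmat 0 0"
  "aff_rep s3 = Aff Amat 1 0"
proof -
  have "\<exists>h. is_hom h \<and> h s1 = Aff Amat 0 0 \<and> h s2 = Aff Bmat 0 0 \<and> h s3 = Aff Amat 1 0"
    by (rule b4_hom_exists[of "Aff Amat 0 0" "Aff Bmat 0 0" "Aff Amat 1 0" "Aff (adj Amat) 0 0"
        "Aff (adj Bmat) 0 0" "Aff (adj Amat) (- 1) 0"])
      (auto simp: is_hom_def Amat_def Bmat_def one_aff_def one_mat_def)
  then have "is_hom aff_rep \<and> aff_rep s1 = Aff Amat 0 0 \<and> aff_rep s2 = Aff Bmat 0 0 \<and> aff_rep s3 = Aff Amat 1 0"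
    unfolding aff_rep_def by (rule someI_ex)
  then show "is_hom aff_rep" "aff_rep s1 = Aff Amat 0 0" "aff_rep s2 = Aff Bmat 0 0"
    "aff_rep s3 = Aff Amat 1 0" by auto
qed

text \<open>The composite of the exceptional homomorphism with the standard representation of the
  three-strand group in SL(2,Z).\<close>

definition sl_rep :: "b4 \<Rightarrow> mat" where "sl_rep g = lin (aff_rep g)"

lemma sl_rep_hom: "is_hom sl_rep"
  using aff_rep(1) by (simp add: is_hom_def sl_rep_def)

lemmas sl_rep_simps [simp] = is_homD(1-3)[OF sl_rep_hom]

lemma sl_rep_gens: "sl_rep s1 = Amat" "sl_rep s2 = Bmat" "sl_rep s3 = Amat"
  by (simp_all add: sl_rep_def aff_rep)

lemma sl_rep_ginv_gens: "sl_rep (ginv s1) = adj Amat" "sl_rep (ginv s2) = adj Bmat" "sl_rep (ginv s3) = adj Amat"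
  using is_homD(4)[OF sl_rep_hom, of s1] is_homD(4)[OF sl_rep_hom, of s2] is_homD(4)[OF sl_rep_hom, of s3]
    mat_right_cancel[of Amat "sl_rep (ginv s1)" "adj Amat"]
    mat_right_cancel[of Bmat "sl_rep (ginv s2)" "adj Bmat"]
    mat_right_cancel[of Amat "sl_rep (ginv s3)" "adj Amat"]
  by (simp_all add: sl_rep_gens Amat_def Bmat_def one_mat_def)

lemma det_sl_rep [simp]: "det (sl_rep g) = 1"
  by (induction g rule: b4_induct) (simp_all add: sl_rep_gens sl_rep_ginv_gens, simp_all add: Amat_def Bmat_def)

lemma sl_rep_ginv [simp]: "sl_rep (ginv g) = adj (sl_rep g)"
  using is_homD(4)[OF sl_rep_hom, of g] mat_right_cancel[of "sl_rep g"] adj_left det_sl_rep by metis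

text \<open>The exponent sum \<open>k\<close> is recorded as \<open>2\<^sup>k\<close>, so that it takes values in a multiplicative monoid.\<close>

definition expo :: "b4 \<Rightarrow> real" where
  "expo = (SOME h. is_hom h \<and> h s1 = 2 \<and> h s2 = 2 \<and> h s3 = 2)"

lemma expo: "is_hom expo" "expo s1 = 2" "expo s2 = 2" "expo s3 = 2"
proof -
  have "\<exists>h :: b4 \<Rightarrow> real. is_hom h \<and> h s1 = 2 \<and> h s2 = 2 \<and> h s3 = 2"
    by (rule b4_hom_exists[of 2 2 "2 :: real" "1 / 2" "1 / 2" "1 / 2"]) (auto simp: is_hom_def)
  then have "is_hom expo \<and> expo s1 = 2 \<and> expo s2 = 2 \<and> expo s3 = 2"
    unfolding expo_def by (rule someI_ex)
  then show "is_hom expo" "expo s1 = 2" "expo s2 = 2" "expo s3 = 2" by auto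
qed

lemmas expo_simps [simp] = is_homD(1-3)[OF expo(1)]

lemma expo_nonzero [simp]: "expo g \<noteq> 0"
  using is_homD(4)[OF expo(1), of g] by auto

lemma expo_ginv [simp]: "expo (ginv g) = inverse (expo g)"
  using inverse_unique[OF is_homD(5)[OF expo(1), of g]] by simp

text \<open>The orientation-reversing automorphism. It is used in \<open>sl_rep_normalize\<close>,
  when the matrix of \<open>a\<close> comes out as the inverse of \<open>Amat\<close>.\<close>

definition mirror :: "b4 \<Rightarrow> b4" where
  "mirror = (SOME h. is_hom h \<and> h s1 = ginv s1 \<and> h s2 = ginv s2 \<and> h s3 = ginv s3)"

lemma mirror: "is_hom mirror" "mirror s1 = ginv s1" "mirror s2 = ginv s2" "mirror s3 = ginv s3"
proof -
  have "\<exists>h. is_hom h \<and> h s1 = ginv s1 \<and> h s2 = ginv s2 \<and> h s3 = ginv s3"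
  proof (rule b4_hom_exists[of "ginv s1" "ginv s2" "ginv s3" s1 s2 s3])
    show "ginv s1 * ginv s2 * ginv s1 = ginv s2 * ginv s1 * ginv s2"
      "ginv s2 * ginv s3 * ginv s2 = ginv s3 * ginv s2 * ginv s3" "ginv s1 * ginv s3 = ginv s3 * ginv s1"
      using arg_cong[OF braid_relations(1), of ginv] arg_cong[OF braid_relations(2), of ginv]
        arg_cong[OF braid_relations(3), of ginv] by (simp_all add: mult.assoc)
  qed (auto simp: is_hom_def)
  then have "is_hom mirror \<and> mirror s1 = ginv s1 \<and> mirror s2 = ginv s2 \<and> mirror s3 = ginv s3"
    unfolding mirror_def by (rule someI_ex)
  then show "is_hom mirror" "mirror s1 = ginv s1" "mirror s2 = ginv s2" "mirror s3 = ginv s3" by auto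
qed

lemmas mirror_simps [simp] = is_homD(1-3)[OF mirror(1)]

lemma mirror_ginv [simp]: "mirror (ginv g) = ginv (mirror g)"
  using is_homD(5)[OF mirror(1), of g] by (metis ginv_unique)

lemma mirror_mirror [simp]: "mirror (mirror g) = g"
  by (induction g rule: b4_induct) (simp_all add: mirror)

lemma sl_rep_mirror: "sl_rep (mirror g) = Mat 1 0 0 (- 1) * sl_rep g * Mat 1 0 0 (- 1)"
proof -
  let ?S = "Mat 1 0 0 (- 1)"
  have push: "adj Amat * (?S * x) = ?S * (Amat * x)" "adj Bmat * (?S * x) = ?S * (Bmat * x)"
    "Amat * (?S * x) = ?S * (adj Amat * x)" "Bmat * (?S * x) = ?S * (adj Bmat * x)" for x
    by (cases x; simp add: Amat_def Bmat_def)+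
  have adj_adj: "adj (adj x) = x" for x by (cases x) simp
  show ?thesis
  proof (induction g rule: b4_induct)
    case one
    show ?case by (simp add: one_mat_def)
  qed (simp_all only: mirror sl_rep_simps mirror_simps mirror_ginv sl_rep_ginv ginv_ginv sl_rep_gens
      push mult.assoc adj_adj)
qed

section \<open>The centre and the kernel of the projection to PSL(2,Z)\<close>

definition beta :: b4 ("\<beta>") where "\<beta> = s1 * (s2 * s3)"
definition gamma :: b4 ("\<gamma>") where "\<gamma> = \<beta> * s1"

interpretation S: braid_triple s1 s2 s3
  rewrites "braid_triple.bet s1 s2 s3 = \<beta>" and "braid_triple.gam s1 s2 s3 = \<gamma>"
proof -
  show s: "braid_triple s1 s2 s3"
    by unfold_locales (rule braid_relations)+
  show b: "braid_triple.bet s1 s2 s3 = \<beta>"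
    by (simp only: braid_triple.bet_def[OF s] beta_def)
  show "braid_triple.gam s1 s2 s3 = \<gamma>"
    by (simp only: braid_triple.gam_def[OF s] b gamma_def)
qed

abbreviation \<zeta> :: b4 where "\<zeta> \<equiv> \<beta> ^ 4"

lemma zeta_commute: "\<zeta> * g = g * \<zeta>"
proof -
  have s: "\<zeta> * s1 = s1 * \<zeta>" "\<zeta> * s2 = s2 * \<zeta>" "\<zeta> * s3 = s3 * \<zeta>"
    by (rule S.bet4_a, rule S.bet4_b, simp only: mult_left_cancel_group, rule S.bet4_c)
  have mult: "\<zeta> * (x * y) = (x * y) * \<zeta>" if "\<zeta> * x = x * \<zeta>" "\<zeta> * y = y * \<zeta>" for x y
    using that by (metis mult.assoc)
  show ?thesis
  proof (induction g rule: b4_induct)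
    case one show ?case by simp
  qed (rule mult, rule s ginv_commute[OF s(1), symmetric] ginv_commute[OF s(2), symmetric]
      ginv_commute[OF s(3), symmetric] ginv_commute, (rule s)?, assumption?)+
qed

text \<open>The cyclic group generated by \<open>\<zeta>\<close>; a pair of natural exponents stands
  for one integer exponent.\<close>

definition Cz :: "b4 set" where "Cz = {t. \<exists>m n. t * \<zeta> ^ m = \<zeta> ^ n}"

lemma zeta_pow_commute: "\<zeta> ^ n * g = g * \<zeta> ^ n"
  by (rule power_commuting_commutes) (rule zeta_commute)

lemma Cz_commute: "t \<in> Cz \<Longrightarrow> t * g = g * t"
proof -
  assume "t \<in> Cz"
  then obtain m n where t: "t * \<zeta> ^ m = \<zeta> ^ n" by (auto simp: Cz_def)
  have "(t * g) * \<zeta> ^ m = t * \<zeta> ^ m * g" by (simp only: mult.assoc zeta_pow_commute[of m g])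
  also have "\<dots> = (g * t) * \<zeta> ^ m" unfolding t by (simp only: zeta_pow_commute mult.assoc t)
  finally show ?thesis by (simp only: mult_right_cancel_group)
qed

lemma Cz_zeta [simp]: "\<zeta> ^ n \<in> Cz"
  unfolding Cz_def by (rule CollectI, rule exI[of _ 0], rule exI[of _ n]) simp

lemma Cz_one [simp]: "1 \<in> Cz"
  using Cz_zeta[of 0] by simp

lemma Cz_zeta1 [simp]: "\<zeta> \<in> Cz"
  using Cz_zeta[of 1] by simp

lemma Cz_mult: "t \<in> Cz \<Longrightarrow> u \<in> Cz \<Longrightarrow> t * u \<in> Cz"
proof -
  assume "t \<in> Cz" and u: "u \<in> Cz"
  then obtain m n m' n' where t: "t * \<zeta> ^ m = \<zeta> ^ n" "u * \<zeta> ^ m' = \<zeta> ^ n'"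
    unfolding Cz_def by blast
  have "t * u * \<zeta> ^ (m + m') = t * (u * \<zeta> ^ m) * \<zeta> ^ m'"
    by (simp only: power_add mult.assoc)
  also have "\<dots> = (t * \<zeta> ^ m) * (u * \<zeta> ^ m')"
    by (simp only: zeta_pow_commute[of m u, symmetric] mult.assoc)
  finally have "t * u * \<zeta> ^ (m + m') = \<zeta> ^ (n + n')" by (simp only: t power_add)
  then show ?thesis unfolding Cz_def by blast
qed

lemma Cz_ginv: "t \<in> Cz \<Longrightarrow> ginv t \<in> Cz"
proof -
  assume "t \<in> Cz"
  then obtain m n where t: "t * \<zeta> ^ m = \<zeta> ^ n" unfolding Cz_def by blast
  have "ginv t * \<zeta> ^ n = \<zeta> ^ m" unfolding t[symmetric] by simp
  then show ?thesis unfolding Cz_def by blast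
qed

lemma sl_rep_bet: "sl_rep \<beta> = Mat 0 1 (- 1) 0"
  and sl_rep_gam: "sl_rep \<gamma> = Mat 0 1 (- 1) (- 1)"
  by (simp_all add: S.bet_def S.gam_def sl_rep_gens Amat_def Bmat_def)

text \<open>A half-turn of the plane, so that \<open>\<zeta>\<close>, its square, acts
  trivially.\<close>

lemma aff_rep_bet2: "aff_rep (\<beta> * \<beta>) = Aff (- 1) (- 1) (- 1)"
  by (simp add: S.bet_def is_homD(2)[OF aff_rep(1)] aff_rep Amat_def Bmat_def one_mat_def)

lemma aff_rep_zeta: "aff_rep \<zeta> = 1"
proof -
  have "aff_rep \<zeta> = aff_rep (\<beta> * \<beta>) * aff_rep (\<beta> * \<beta>)"
    by (simp only: is_homD(2)[OF aff_rep(1)] S.bet_pow4 mult.assoc)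
  then show ?thesis by (simp add: aff_rep_bet2 one_aff_def one_mat_def)
qed

lemma aff_rep_Cz: "t \<in> Cz \<Longrightarrow> aff_rep t = 1"
proof -
  assume "t \<in> Cz"
  then obtain m n where t: "t * \<zeta> ^ m = \<zeta> ^ n" unfolding Cz_def by blast
  have "aff_rep t * aff_rep (\<zeta> ^ m) = aff_rep (\<zeta> ^ n)"
    unfolding t[symmetric] by (simp only: is_homD(2)[OF aff_rep(1)])
  moreover have "aff_rep (\<zeta> ^ k) = 1" for k
    by (simp only: is_homD(3)[OF aff_rep(1), of \<zeta>] aff_rep_zeta power_one)
  ultimately show ?thesis by simp
qed

lemma sl_rep_Cz: "t \<in> Cz \<Longrightarrow> sl_rep t = 1"
  by (simp add: sl_rep_def aff_rep_Cz)

text \<open>\<open>\<zeta>\<close> has exponent sum 12, so its powers are told apart by their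
  exponent sums.\<close>

lemma expo_Cz: "t \<in> Cz \<Longrightarrow> expo t = 1 \<Longrightarrow> t = 1"
proof -
  assume "t \<in> Cz" and e: "expo t = 1"
  then obtain m n where t: "t * \<zeta> ^ m = \<zeta> ^ n" unfolding Cz_def by blast
  have z: "expo \<zeta> = 2 ^ 12" by (simp add: S.bet_def expo)
  have "expo \<zeta> ^ m = expo \<zeta> ^ n" using arg_cong[OF t, of expo] e by simp
  then have "m = n" unfolding z by (simp add: power_inject_exp)
  then have "t * \<zeta> ^ m = 1 * \<zeta> ^ m" using t by simp
  then show ?thesis by (simp only: mult_right_cancel_group)
qed

section \<open>Congruence modulo the centre\<close>

definition ceq :: "b4 \<Rightarrow> b4 \<Rightarrow> bool" (infix "\<approx>" 50) where
  "g \<approx> h \<longleftrightarrow> (\<exists>t\<in>Cz. g = h * t)"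

lemma ceq_refl [simp, intro]: "g \<approx> g"
  unfolding ceq_def by (rule bexI[of _ 1]) simp_all

lemma ceq_sym: "g \<approx> h \<Longrightarrow> h \<approx> g"
  unfolding ceq_def by (auto intro!: bexI[of _ "ginv _"] Cz_ginv simp: mult.assoc)

lemma ceq_trans [trans]: "g \<approx> h \<Longrightarrow> h \<approx> k \<Longrightarrow> g \<approx> k"
  unfolding ceq_def by (auto simp: mult.assoc intro: Cz_mult)

lemma ceq_mult: "g \<approx> g' \<Longrightarrow> h \<approx> h' \<Longrightarrow> g * h \<approx> g' * h'"
proof -
  assume "g \<approx> g'" "h \<approx> h'"
  then obtain t u where t: "t \<in> Cz" "g = g' * t" and u: "u \<in> Cz" "h = h' * u"
    unfolding ceq_def by auto
  have "g * h = g' * h' * (t * u)"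
    unfolding t(2) u(2) using Cz_commute[OF t(1), of h'] by (metis mult.assoc)
  then show ?thesis unfolding ceq_def using Cz_mult t u by blast
qed

lemma ceq_left: "h \<approx> h' \<Longrightarrow> g * h \<approx> g * h'" and ceq_right: "h \<approx> h' \<Longrightarrow> h * g \<approx> h' * g"
  by (auto intro: ceq_mult)

lemma ceq_ginv: "g \<approx> h \<Longrightarrow> ginv g \<approx> ginv h"
proof -
  assume "g \<approx> h"
  then obtain t where t: "t \<in> Cz" "g = h * t" unfolding ceq_def by auto
  have "ginv g = ginv h * ginv t" unfolding t(2) using Cz_commute[OF Cz_ginv[OF t(1)]] by simp
  then show ?thesis unfolding ceq_def using Cz_ginv t by blast
qed

lemma ceq_one_iff: "g \<approx> 1 \<longleftrightarrow> g \<in> Cz"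
  unfolding ceq_def by auto

lemma ceq_expo: "g \<approx> h \<Longrightarrow> expo g = expo h \<Longrightarrow> g = h"
proof -
  assume "g \<approx> h" and e: "expo g = expo h"
  then obtain t where t: "t \<in> Cz" "g = h * t" unfolding ceq_def by blast
  then have "expo t = 1" using e by simp
  then show ?thesis using expo_Cz[OF t(1)] t(2) by simp
qed

lemma ceq_sl_rep: "g \<approx> h \<Longrightarrow> sl_rep g = sl_rep h"
  unfolding ceq_def using sl_rep_Cz by auto

lemma ceq_mult_Cz: "t \<in> Cz \<Longrightarrow> g * t \<approx> g"
  unfolding ceq_def by blast

lemma ceq_cancel_left: "g * h \<approx> g * h' \<Longrightarrow> h \<approx> h'"
  using ceq_left[of "g * h" "g * h'" "ginv g"] by simp

lemma ceq_cancel_right: "h * g \<approx> h' * g \<Longrightarrow> h \<approx> h'"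
  using ceq_right[of "h * g" "h' * g" "ginv g"] by (simp add: mult.assoc)

section \<open>The three involutions and a normal form\<close>

datatype tri = T0 | T1 | T2

fun rot :: "tri \<Rightarrow> tri" where "rot T0 = T1" | "rot T1 = T2" | "rot T2 = T0"

fun eps :: "tri \<Rightarrow> b4" where
  "eps T0 = \<beta> * \<beta>"
| "eps T1 = \<gamma> * (\<beta> * \<beta>) * ginv \<gamma>"
| "eps T2 = \<gamma> * (\<gamma> * (\<beta> * \<beta>) * ginv \<gamma>) * ginv \<gamma>"

abbreviation om :: "tri list \<Rightarrow> b4" where "om \<equiv> ev eps"

lemma eps_square: "eps i * eps i = \<zeta>"
proof -
  have c: "g * \<zeta> * ginv g = \<zeta>" for g by (simp add: zeta_commute[symmetric] mult.assoc)
  have 0: "\<beta> * \<beta> * (\<beta> * \<beta>) = \<zeta>" by (simp only: S.bet_pow4 mult.assoc)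
  have sq: "(g * x * ginv g) * (g * x * ginv g) = g * (x * x) * ginv g" for g x :: b4
    by (simp add: mult.assoc)
  show ?thesis by (cases i) (simp_all only: eps.simps sq 0 c)
qed

lemma sl_rep_eps [simp]: "sl_rep (eps i) = - 1"
  by (cases i) (simp_all add: sl_rep_bet sl_rep_gam one_mat_def)

lemma sl_rep_om: "sl_rep (om w) = (- 1) ^ length w"
  by (induction w) simp_all

lemma expo_eps [simp]: "expo (eps i) = 2 ^ 6"
  by (cases i) (simp_all add: S.bet_def S.gam_def expo)

lemma gam_eps: "\<gamma> * eps i = eps (rot i) * \<gamma>"
proof (cases i)
  case T2
  have g: "\<gamma> * (\<gamma> * \<gamma>) = \<zeta>" using S.gam3 by (simp add: numeral_eq_Suc mult.assoc)
  have "\<gamma> * eps T2 * (\<gamma> * \<gamma>) = (\<gamma> * (\<gamma> * \<gamma>)) * (\<beta> * \<beta>)"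
    by (simp add: mult.assoc)
  also have "\<dots> = (\<beta> * \<beta>) * (\<gamma> * (\<gamma> * \<gamma>))" unfolding g by (rule zeta_commute)
  finally have "\<gamma> * eps T2 * (\<gamma> * \<gamma>) = eps T0 * \<gamma> * (\<gamma> * \<gamma>)"
    by (simp add: mult.assoc)
  then show ?thesis unfolding T2 mult_right_cancel_group rot.simps .
qed (simp_all add: mult.assoc)

lemma gam_om: "\<gamma> * om w = om (map rot w) * \<gamma>"
proof (induction w)
  case (Cons i w)
  have "\<gamma> * om (i # w) = (\<gamma> * eps i) * om w" by (simp only: ev_simps mult.assoc)
  also have "\<dots> = eps (rot i) * (\<gamma> * om w)" by (simp only: gam_eps mult.assoc)
  finally show ?case unfolding Cons by (simp add: mult.assoc)
qed simp

text \<open>Multiplying by \<open>\<gamma>\<close> on the left and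
  \<open>\<gamma> * \<beta> * \<gamma>\<close> on the right clears the inverses in
  \<open>eps\<close>; what remains is the commutation of \<open>\<beta> * \<beta>\<close> with
  \<open>\<gamma> * \<beta> * \<gamma>\<close>.\<close>

lemma bet_eps1: "\<beta> * eps T1 = eps T2 * \<beta>"
proof -
  have "\<gamma> * (\<beta> * eps T1) * (\<gamma> * \<beta> * \<gamma>) = \<gamma> * \<beta> * \<gamma> * (\<beta> * \<beta>) * (\<beta> * \<gamma>)"
    by (simp add: mult.assoc)
  also have "\<dots> = (\<beta> * \<beta>) * (\<gamma> * \<beta> * \<gamma>) * (\<beta> * \<gamma>)"
    using S.bet2_gam_bet_gam by (simp only: mult.assoc)
  also have "\<dots> = eps T0 * \<gamma> * (\<beta> * \<gamma> * \<beta> * \<gamma>)" by (simp add: mult.assoc)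
  also have "\<dots> = \<gamma> * (eps T2 * \<beta>) * (\<gamma> * \<beta> * \<gamma>)"
    using gam_eps[of T2] by (simp only: rot.simps mult.assoc[symmetric])
  finally show ?thesis by (simp only: mult_right_cancel_group mult_left_cancel_group)
qed

text \<open>Conjugation by \<open>\<beta>\<close> modulo the centre, as a substitution on
  words.\<close>

fun bsub :: "tri \<Rightarrow> tri list" where
  "bsub T0 = [T0]" | "bsub T1 = [T2]" | "bsub T2 = [T0, T1, T0]"

lemma bet_eps: "\<beta> * eps i \<approx> om (bsub i) * \<beta>"
proof (cases i)
  case T2
  have "\<beta> * eps T2 * \<beta> = \<beta> * (\<beta> * eps T1)" by (simp only: bet_eps1 mult.assoc)
  \<comment> \<open>The factor \<open>\<zeta>\<close> supplies the last letter \<open>T0\<close> of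
    \<open>bsub T2\<close> together with the remaining \<open>\<beta> * \<beta>\<close>.\<close>
  also have "\<dots> * (\<beta> * \<beta> * (\<beta> * \<beta>)) = om (bsub T2) * \<beta> * \<beta>"
    using zeta_commute[of "eps T1", unfolded S.bet_pow4] by (simp add: mult.assoc)
  finally have "\<beta> * eps T2 * \<beta> * \<zeta> = om (bsub T2) * \<beta> * \<beta>"
    by (simp only: S.bet_pow4 mult.assoc)
  then have "\<beta> * eps T2 * \<beta> \<approx> om (bsub T2) * \<beta> * \<beta>"
    by (metis ceq_sym ceq_mult_Cz Cz_zeta1)
  then show ?thesis unfolding T2 by (rule ceq_cancel_right)
qed (simp_all only: bsub.simps ev_simps bet_eps1 mult_1_right ceq_refl, simp add: mult.assoc)

lemma bet_om: "\<beta> * om w \<approx> om (concat (map bsub w)) * \<beta>"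
proof (induction w)
  case (Cons i w)
  have "\<beta> * om (i # w) = (\<beta> * eps i) * om w" by (simp only: ev_simps mult.assoc)
  also have "\<dots> \<approx> om (bsub i) * (\<beta> * om w)"
    using ceq_right[OF bet_eps, of i "om w"] by (simp only: mult.assoc)
  also have "\<dots> \<approx> om (bsub i) * (om (concat (map bsub w)) * \<beta>)" by (rule ceq_left[OF Cons])
  finally show ?case by (simp add: mult.assoc)
qed simp

text \<open>The matrices of \<open>\<beta>\<gamma>\<close> and \<open>\<beta>\<gamma>\<^sup>2\<close> are, up to sign, unipotent with nonnegative entries, so their
  nonempty products are never scalar.\<close>

definition pv :: "bool list \<Rightarrow> b4" where
  "pv = ev (\<lambda>b. if b then \<beta> * \<gamma> else \<beta> * (\<gamma> * \<gamma>))"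

lemma pv_simps [simp]:
  "pv [] = 1" "pv (True # v) = \<beta> * (\<gamma> * pv v)" "pv (False # v) = \<beta> * (\<gamma> * (\<gamma> * pv v))"
  by (simp_all add: pv_def mult.assoc)

text \<open>Modulo the centre and the words \<open>om w\<close>, the elements \<open>\<beta>\<close>
  and \<open>\<gamma>\<close> have orders 2 and 3, which leaves an alternating product. The set
  \<open>X\<close> is closed under left multiplication by both, and by their inverses, which are
  congruent to positive powers; these generate the group.\<close>

lemma normal_form:
  "\<exists>w e v f. e < 3 \<and> f < 2 \<and> g \<approx> om w * (\<gamma> ^ e * (pv v * \<beta> ^ f))"
proof -
  define X where "X g \<longleftrightarrow> (\<exists>w e v f. e < 3 \<and> f < 2 \<and> g \<approx> om w * (\<gamma> ^ e * (pv v * \<beta> ^ f)))" for g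
  have XI: "X g" if "e < 3" "f < 2" "g \<approx> om w * (\<gamma> ^ e * (pv v * \<beta> ^ f))" for g w e v f
    unfolding X_def using that by blast
  have Xc: "X g" if "X h" "g \<approx> h" for g h
    using that ceq_trans unfolding X_def by blast
  have g3: "\<gamma> * (\<gamma> * \<gamma>) = \<zeta>" using S.gam3 by (simp add: numeral_eq_Suc mult.assoc)
  have gX: "X (\<gamma> * g)" if "X g" for g
  proof -
    obtain w e v f where h: "e < 3" "f < 2" "g \<approx> om w * (\<gamma> ^ e * (pv v * \<beta> ^ f))"
      using \<open>X g\<close> unfolding X_def by blast
    have 1: "\<gamma> * g \<approx> om (map rot w) * (\<gamma> ^ Suc e * (pv v * \<beta> ^ f))"
      using ceq_left[OF h(3), of \<gamma>] gam_om[of w] by (simp add: mult.assoc[symmetric])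
    show ?thesis
    proof (cases "e = 2")
      case True
      have "\<gamma> ^ Suc e * (pv v * \<beta> ^ f) = pv v * \<beta> ^ f * \<zeta>"
        using zeta_commute[of "pv v * \<beta> ^ f"] g3 True by (simp add: numeral_eq_Suc)
      then have "\<gamma> * g \<approx> om (map rot w) * (pv v * \<beta> ^ f) * \<zeta>"
        using 1 by (simp add: mult.assoc)
      then have "\<gamma> * g \<approx> om (map rot w) * (\<gamma> ^ 0 * (pv v * \<beta> ^ f))"
        using ceq_trans[OF _ ceq_mult_Cz[OF Cz_zeta1]] by simp
      then show ?thesis using XI[of 0] h(2) by simp
    next
      case False
      then show ?thesis using XI[OF _ h(2) 1] h(1) by simp
    qed
  qed
  have bX: "X (\<beta> * g)" if "X g" for g
  proof -
    obtain w e v f where h: "e < 3" "f < 2" "g \<approx> om w * (\<gamma> ^ e * (pv v * \<beta> ^ f))"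
      using \<open>X g\<close> unfolding X_def by blast
    let ?w = "concat (map bsub w)"
    have "\<beta> * g \<approx> \<beta> * om w * (\<gamma> ^ e * (pv v * \<beta> ^ f))"
      using ceq_left[OF h(3), of \<beta>] by (simp add: mult.assoc)
    also have "\<dots> \<approx> om ?w * \<beta> * (\<gamma> ^ e * (pv v * \<beta> ^ f))"
      by (rule ceq_right[OF bet_om])
    finally have bg: "\<beta> * g \<approx> om ?w * (\<beta> * (\<gamma> ^ e * (pv v * \<beta> ^ f)))"
      by (simp add: mult.assoc)
    \<comment> \<open>For \<open>e = 1\<close> or \<open>e = 2\<close> the new
      \<open>\<beta>\<close> and the power of \<open>\<gamma>\<close> form a letter of
      \<open>pv\<close>. For \<open>e = 0\<close> the new \<open>\<beta>\<close> either becomes the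
      final \<open>\<beta>\<close> or meets another one, and
      \<open>\<beta> * \<beta> = eps T0\<close> is absorbed into \<open>w\<close>.\<close>
    consider "e = 1" | "e = 2" | "e = 0" "v = []" "f = 0" | "e = 0" "v = []" "f = 1"
      | v' where "e = 0" "v = True # v'" | v' where "e = 0" "v = False # v'"
    proof -
      have e: "e = 0 \<or> e = 1 \<or> e = 2" and f: "f = 0 \<or> f = 1" using h(1,2) by auto
      have v: "v = [] \<or> (\<exists>v'. v = True # v') \<or> (\<exists>v'. v = False # v')"
        by (cases v; cases "hd v") auto
      show ?thesis
      proof (cases "e = 0")
        case True
        show ?thesis
          using v f by (elim disjE exE) (erule (1) that(3-6)[OF True] | erule that(5,6)[OF True])+
      next
        case False
        then show ?thesis using e that(1,2) by metis
      qed
    qed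
    then show ?thesis
    proof cases
      case 1
      then show ?thesis using bg XI[of 0 f "\<beta> * g" ?w "True # v"] h(2) by (simp add: mult.assoc)
    next
      case 2
      then show ?thesis using bg XI[of 0 f "\<beta> * g" ?w "False # v"] h(2)
        by (simp add: mult.assoc numeral_eq_Suc)
    next
      case 3
      then show ?thesis using bg XI[of 0 1 "\<beta> * g" ?w "[]"] by simp
    next
      case 4
      then show ?thesis using bg XI[of 0 0 "\<beta> * g" "?w @ [T0]" "[]"] by (simp add: mult.assoc)
    next
      case (5 v')
      then show ?thesis using bg XI[of 1 f "\<beta> * g" "?w @ [T0]" v'] h(2) by (simp add: mult.assoc)
    next
      case (6 v')
      then show ?thesis using bg XI[of 2 f "\<beta> * g" "?w @ [T0]" v'] h(2)
        by (simp add: mult.assoc numeral_eq_Suc)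
    qed
  qed
  have cancel: "ginv x * g \<approx> y * g" if "x * y = \<zeta>" for x y g
  proof (rule ceq_sym)
    have "y * g = ginv x * g * \<zeta>" using that zeta_commute[of g] by (metis ginv_left_assoc mult.assoc)
    then show "y * g \<approx> ginv x * g" by (simp only: ceq_mult_Cz Cz_zeta1)
  qed
  have gX': "X (ginv \<gamma> * g)" if "X g" for g
    using Xc[OF gX[OF gX[OF that]] cancel[OF g3, of g, unfolded mult.assoc]] .
  have bX': "X (ginv \<beta> * g)" if "X g" for g
    using Xc[OF bX[OF bX[OF bX[OF that]]] cancel[OF S.bet_pow4[symmetric], of g, unfolded mult.assoc]] .
  have s: "s1 = ginv \<beta> * \<gamma>" "s2 = \<gamma> * ginv \<beta>" "s3 = \<beta> * (\<gamma> * (ginv \<beta> * ginv \<beta>))"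
  proof -
    show 1: "s1 = ginv \<beta> * \<gamma>" by (simp add: S.gam_def)
    have "s2 * \<beta> = \<gamma>" using S.bet_a by (simp add: S.gam_def)
    then show 2: "s2 = \<gamma> * ginv \<beta>" by (metis ginv_right mult.assoc mult_1_right)
    have "s3 * \<beta> = \<beta> * s2" using S.bet_b by simp
    then have "s3 = \<beta> * s2 * ginv \<beta>" by (metis ginv_right mult.assoc mult_1_right)
    then show "s3 = \<beta> * (\<gamma> * (ginv \<beta> * ginv \<beta>))" unfolding 2 by (simp add: mult.assoc)
  qed
  have "X g"
  proof (induction g rule: b4_induct)
    case one
    show ?case by (rule XI[of 0 0 _ "[]" "[]"]) simp_all
  qed (simp_all only: s ginv_mult ginv_ginv mult.assoc gX bX gX' bX')
  then show ?thesis unfolding X_def .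
qed

lemma sl_rep_pv:
  "\<exists>a b c d. (sl_rep (pv v) = Mat a b c d \<or> sl_rep (pv v) = - Mat a b c d) \<and>
    a \<ge> 1 \<and> d \<ge> 1 \<and> b \<ge> 0 \<and> c \<ge> 0 \<and> (v \<noteq> [] \<longrightarrow> b + c \<ge> 1)"
proof (induction v)
  case Nil
  have "sl_rep (pv []) = Mat 1 0 0 1" by (simp add: one_mat_def)
  then show ?case by fastforce
next
  case (Cons x v)
  then obtain a b c d where h: "sl_rep (pv v) = Mat a b c d \<or> sl_rep (pv v) = - Mat a b c d"
    "a \<ge> 1" "d \<ge> 1" "b \<ge> 0" "c \<ge> 0" by blast
  show ?case
  proof (cases x)
    case True
    have "sl_rep (pv (x # v)) = Mat (a + c) (b + d) c d \<or> sl_rep (pv (x # v)) = - Mat (a + c) (b + d) c d"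
      using h(1) by (auto simp: True sl_rep_bet sl_rep_gam)
    moreover have "a + c \<ge> 1" "b + d \<ge> 0" "(b + d) + c \<ge> 1" using h by auto
    ultimately show ?thesis using h(3,5) by blast
  next
    case False
    have "sl_rep (pv (x # v)) = Mat a b (a + c) (b + d) \<or> sl_rep (pv (x # v)) = - Mat a b (a + c) (b + d)"
      using h(1) by (auto simp: False sl_rep_bet sl_rep_gam)
    moreover have "b + d \<ge> 1" "a + c \<ge> 0" "b + (a + c) \<ge> 1" using h by auto
    ultimately show ?thesis using h(2,4) by blast
  qed
qed

text \<open>In the normal form, \<open>om w\<close> has matrix plus or minus 1. The signs of the
  entries in \<open>sl_rep_pv\<close> then force \<open>e = 0\<close>, \<open>f = 0\<close> and
  \<open>v = []\<close>.\<close>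

lemma sl_rep_kernel:
  assumes "sl_rep g = 1 \<or> sl_rep g = - 1"
  shows "\<exists>w. g \<approx> om w"
proof -
  obtain w e v f where h: "e < 3" "f < 2" "g \<approx> om w * (\<gamma> ^ e * (pv v * \<beta> ^ f))"
    using normal_form by blast
  let ?x = "sl_rep (\<gamma> ^ e * (pv v * \<beta> ^ f))"
  have "sl_rep (om w) = 1 \<or> sl_rep (om w) = - 1"
    unfolding sl_rep_om by (cases "even (length w)") simp_all
  then have x: "?x = 1 \<or> ?x = - 1"
    using assms ceq_sl_rep[OF h(3)] by (auto simp del: sl_rep_simps simp add: sl_rep_simps(2)[of "om w"]) (metis minus_minus)
  obtain a b c d where m: "sl_rep (pv v) = Mat a b c d \<or> sl_rep (pv v) = - Mat a b c d"
    "a \<ge> 1" "d \<ge> 1" "b \<ge> 0" "c \<ge> 0" "v \<noteq> [] \<longrightarrow> b + c \<ge> 1"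
    using sl_rep_pv by blast
  have e: "e = 0 \<or> e = 1 \<or> e = 2" "f = 0 \<or> f = 1" using h by auto
  have "e = 0 \<and> f = 0 \<and> b = 0 \<and> c = 0"
    using x m(1-5) e by (elim disjE) (auto simp: sl_rep_bet sl_rep_gam one_mat_def numeral_eq_Suc)
  then have "\<gamma> ^ e * (pv v * \<beta> ^ f) = 1" using m(6) by auto
  then show ?thesis using h(3) by auto
qed

section \<open>Faithfulness\<close>

fun rcons :: "tri \<Rightarrow> tri list \<Rightarrow> tri list" where
  "rcons i [] = [i]"
| "rcons i (j # w) = (if i = j then w else i # j # w)"

definition red :: "tri list \<Rightarrow> tri list" where "red w = foldr rcons w []"

lemma red_simps [simp]: "red [] = []" "red (i # w) = rcons i (red w)"
  by (simp_all add: red_def)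

lemma distinct_adj_rcons: "distinct_adj w \<Longrightarrow> distinct_adj (rcons i w)"
  by (cases w; cases "tl w") (auto simp: distinct_adj_Cons)

lemma distinct_adj_red: "distinct_adj (red w)"
  by (induction w) (auto intro: distinct_adj_rcons)

lemma red_reduced: "distinct_adj w \<Longrightarrow> red w = w"
proof (induction w)
  case (Cons i w)
  then show ?case by (cases w) auto
qed simp

text \<open>\<open>n\<close> counts the cancellations, each of which costs two letters, one factor
  \<open>\<zeta>\<close> and one sign. Sharing \<open>n\<close> between the three statements allows
  signs to be read off from lengths.\<close>

lemma red_length:
  fixes X :: "tri \<Rightarrow> 'm :: ring_1"
  assumes "\<And>i. X i * X i = - 1"
  shows "\<exists>n. length w = length (red w) + 2 * n \<and> om w = om (red w) * \<zeta> ^ n \<and>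
    ev X w = (- 1) ^ n * ev X (red w)"
proof (induction w)
  case (Cons i w)
  then obtain n where n: "length w = length (red w) + 2 * n" "om w = om (red w) * \<zeta> ^ n"
    "ev X w = (- 1) ^ n * ev X (red w)" by blast
  have m: "X i * ((- 1) ^ n * y) = (- 1) ^ n * (X i * y)" for y
    by (cases "even n") simp_all
  show ?case
  proof (cases "\<exists>v. red w = i # v")
    case True
    then obtain v where v: "red w = i # v" by blast
    have "eps i * (eps i * x) = \<zeta> * x" for x by (simp flip: mult.assoc add: eps_square)
    then have "om (i # w) = om v * \<zeta> ^ Suc n"
      using zeta_commute[of "om v * \<zeta> ^ n"] by (simp add: n(2) v power_commutes mult.assoc)
    moreover have "X i * (X i * y) = - y" for y by (simp flip: mult.assoc add: assms)
    then have "ev X (i # w) = (- 1) ^ Suc n * ev X v"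
      by (simp add: n(3) v m)
    ultimately show ?thesis using n(1) v by (intro exI[of _ "Suc n"]) simp
  next
    case False
    then have "red (i # w) = i # red w" by (cases "red w") auto
    then show ?thesis using n m by (intro exI[of _ n]) (simp add: mult.assoc)
  qed
qed (simp add: exI[of _ 0])

lemma om_red: "om w \<approx> om (red w)"
proof -
  obtain n where "om w = om (red w) * \<zeta> ^ n"
    \<comment> \<open>An arbitrary matrix of square \<open>- 1\<close>; here the equation for
      \<open>om\<close> is extracted.\<close>
    using red_length[of "\<lambda>_. Mat 0 1 (- 1) 0" w] by (auto simp: one_mat_def)
  then show ?thesis by (simp add: ceq_mult_Cz)
qed

section \<open>The action of braids on triples of involutions\<close>

type_synonym triple = "mat \<times> mat \<times> mat"

text \<open>A braid acts on triples from the right, by precomposing a homomorphism from the free product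
  with the automorphism that the braid induces by conjugation; a triple lists the images of the
  three involutions.\<close>

fun step :: "nat letter \<Rightarrow> triple \<Rightarrow> triple" where
  "step (Gen i) (x, y, z) =
    (if i = 1 then (- (x * z * x), y, x)
     else if i = 2 then (y, - (y * x * y), z)
     else (z, z * x * y * x * z, - (z * x * z)))"
| "step (Inv i) (x, y, z) =
    (if i = 1 then (z, y, - (z * x * z))
     else if i = 2 then (- (x * y * x), x, z)
     else (- (x * z * x), x * z * y * z * x, x))"

text \<open>Involutions of PSL(2,Z) lift to matrices of square \<open>- 1\<close>, so
  \<open>- (x * z * x)\<close> in \<open>step\<close> is the conjugate of \<open>z\<close> by
  \<open>x\<close>.\<close>

fun valid :: "triple \<Rightarrow> bool" where
  "valid (x, y, z) \<longleftrightarrow> x * x = - 1 \<and> y * y = - 1 \<and> z * z = - 1"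

definition act :: "braid_word \<Rightarrow> triple \<Rightarrow> triple" where "act w f = fold step w f"

lemma act_simps [simp]: "act [] f = f" "act (a # w) f = act w (step a f)" "act (u @ v) f = act v (act u f)"
  by (simp_all add: act_def)

lemma square_assoc: "x * x = - 1 \<Longrightarrow> x * (x * y) = - (y :: mat)"
  by (simp flip: mult.assoc)

lemma valid_step: "valid f \<Longrightarrow> valid (step a f)"
  by (cases f; cases a) (auto simp: mult.assoc square_assoc)

lemma valid_act: "valid f \<Longrightarrow> valid (act w f)"
  by (induction w arbitrary: f) (simp_all add: valid_step del: valid.simps)

lemma act_braid_eq: "braid_eq 4 u v \<Longrightarrow> valid f \<Longrightarrow> act u f = act v f"
proof (induction arbitrary: f rule: braid_eq.induct)
  case (append u u' v v')
  then show ?case using valid_act by simp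
next
  case (cancel a)
  then show ?case by (cases f; cases a) (auto simp: mult.assoc square_assoc)
next
  case (commute i j)
  then have "i = 1" "j = 3" by auto
  then show ?case using commute by (cases f) (auto simp: mult.assoc square_assoc)
next
  case (braid i)
  then have "i = 1 \<or> i = 2" by auto
  then show ?case using braid by (cases f) (auto simp: mult.assoc square_assoc)
qed auto

definition b4_act :: "b4 \<Rightarrow> triple \<Rightarrow> triple" where "b4_act g f = act (rep_b4 g) f"

lemma b4_act_abs: "w \<in> braid_words 4 \<Longrightarrow> valid f \<Longrightarrow> b4_act (abs_b4 w) f = act w f"
  unfolding b4_act_def by (rule act_braid_eq) (auto intro: Quotient_rep_abs[OF Quotient_b4])

lemma valid_b4_act: "valid f \<Longrightarrow> valid (b4_act g f)"
  by (simp add: b4_act_def valid_act)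

lemma b4_act_mult: "valid f \<Longrightarrow> b4_act (g * h) f = b4_act h (b4_act g f)"
  by (cases g rule: b4_cases; cases h rule: b4_cases) (simp add: abs_b4_mult b4_act_abs valid_act)

lemma b4_act_one: "valid f \<Longrightarrow> b4_act 1 f = f"
  by (simp add: one_b4_def b4_act_abs)

lemma b4_act_gens:
  "valid f \<Longrightarrow> b4_act s1 f = step (Gen 1) f" "valid f \<Longrightarrow> b4_act s2 f = step (Gen 2) f"
  "valid f \<Longrightarrow> b4_act s3 f = step (Gen 3) f"
  by (simp_all add: s1_def s2_def s3_def b4_act_abs)

lemma b4_act_bet: "valid (x, y, z) \<Longrightarrow> b4_act \<beta> (x, y, z) = (x, z, - (x * y * x))"
proof -
  assume v: "valid (x, y, z)"
  have "b4_act \<beta> (x, y, z) = step (Gen 3) (step (Gen 2) (step (Gen 1) (x, y, z)))"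
    using v valid_step unfolding beta_def by (simp only: b4_act_mult valid_b4_act b4_act_gens)
  then show ?thesis using v by (simp add: mult.assoc square_assoc)
qed

lemma b4_act_gam: "valid (x, y, z) \<Longrightarrow> b4_act \<gamma> (x, y, z) = (y, z, x)"
proof -
  assume v: "valid (x, y, z)"
  have "b4_act \<gamma> (x, y, z) = step (Gen 1) (b4_act \<beta> (x, y, z))"
    using v unfolding gamma_def by (simp only: b4_act_mult valid_b4_act b4_act_gens)
  then show ?thesis using v by (simp add: b4_act_bet mult.assoc square_assoc)
qed

lemma b4_act_ginv_gam: "valid (x, y, z) \<Longrightarrow> b4_act (ginv \<gamma>) (x, y, z) = (z, x, y)"
proof -
  assume v: "valid (x, y, z)"
  have "b4_act (\<gamma> * ginv \<gamma>) (z, x, y) = (z, x, y)"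
    using v by (simp only: ginv_right b4_act_one valid.simps)
  then show ?thesis using v by (simp add: b4_act_mult b4_act_gam del: ginv_right)
qed

fun sel :: "triple \<Rightarrow> tri \<Rightarrow> mat" where
  "sel (x, y, z) T0 = x" | "sel (x, y, z) T1 = y" | "sel (x, y, z) T2 = z"

lemma valid_sel: "valid f \<Longrightarrow> sel f i * sel f i = - 1"
  by (cases f; cases i) auto

lemma b4_act_eps: "valid f \<Longrightarrow> sel (b4_act (eps i) f) j = - (sel f i * sel f j * sel f i)"
proof (cases f)
  fix x y z assume f: "f = (x, y, z)" and v: "valid f"
  have vb: "valid (x, - (x * y * x), - (x * z * x))" "valid (x, z, - (x * y * x))" if "valid (x, y, z)" for x y z
    using that by (auto simp: mult.assoc square_assoc)
  have bb: "b4_act (\<beta> * \<beta>) (x, y, z) = (x, - (x * y * x), - (x * z * x))" if "valid (x, y, z)" for x y z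
    using that vb(2)[OF that] by (simp only: b4_act_mult b4_act_bet)
  have va: "valid (y, z, x)" "valid (z, x, y)" using v f by auto
  have e: "b4_act (eps T0) (x, y, z) = (x, - (x * y * x), - (x * z * x))"
    "b4_act (eps T1) (x, y, z) = (- (y * x * y), y, - (y * z * y))"
    "b4_act (eps T2) (x, y, z) = (- (z * x * z), - (z * y * z), z)"
    using v va vb[of x y z] vb[of y z x] vb[of z x y] unfolding f eps.simps
    by (simp_all del: valid.simps add: valid_b4_act b4_act_mult[of _ "\<beta> * \<beta>"] b4_act_mult[of _ "\<gamma>"]
        b4_act_mult[of _ _ "ginv \<gamma>"] b4_act_gam bb b4_act_ginv_gam)
      (simp_all add: b4_act_ginv_gam mult.assoc square_assoc)
  show ?thesis
    using v e f by (cases i; cases j) (simp_all add: mult.assoc square_assoc)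
qed

text \<open>The words \<open>om w\<close> act by inner automorphisms: the evaluation of
  \<open>w\<close> conjugates the triple to its image. Hence the action determines the evaluation up
  to matrices commuting with the triple.\<close>

lemma b4_act_om:
  assumes "valid f"
  shows "ev (sel f) w * sel f j = sel (b4_act (om w) f) j * ev (sel f) w"
  using assms
proof (induction w arbitrary: f)
  case Nil
  then show ?case by (simp add: b4_act_one)
next
  case (Cons i w)
  let ?g = "b4_act (eps i) f"
  let ?x = "sel f i"
  have g: "sel ?g j * ?x = ?x * sel f j" for j
    using valid_sel[OF Cons.prems, of i] by (simp add: b4_act_eps[OF Cons.prems] mult.assoc)
  have c: "ev (sel ?g) w * ?x = ?x * ev (sel f) w"
  proof (induction w)
    case (Cons k w)
    then show ?case using g[of k] by (metis ev_simps(2) mult.assoc)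
  qed simp
  have "ev (sel f) (i # w) * sel f j = ev (sel ?g) w * ?x * sel f j"
    by (simp add: c)
  also have "\<dots> = (ev (sel ?g) w * sel ?g j) * ?x" using g[of j] by (simp only: mult.assoc)
  also have "\<dots> = sel (b4_act (om w) ?g) j * (ev (sel ?g) w * ?x)"
    using Cons.IH[OF valid_b4_act[OF Cons.prems]] by (simp only: mult.assoc)
  finally show ?case unfolding c by (simp add: b4_act_mult[OF Cons.prems])
qed

lemma b4_act_zeta: "valid f \<Longrightarrow> b4_act \<zeta> f = f"
proof -
  assume v: "valid f"
  have s: "f = g" if "\<And>j. sel f j = sel g j" for f g
    using that[of T0] that[of T1] that[of T2] by (cases f; cases g) simp
  show ?thesis
    unfolding eps_square[of T0, symmetric] b4_act_mult[OF v]
    using v valid_b4_act[OF v, of "eps T0"]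
    by (intro s) (simp add: b4_act_eps mult.assoc square_assoc valid_sel del: eps.simps)
qed

lemma b4_act_Cz: "t \<in> Cz \<Longrightarrow> valid f \<Longrightarrow> b4_act t f = f"
proof -
  assume "t \<in> Cz" and v: "valid f"
  then obtain m n where t: "t * \<zeta> ^ m = \<zeta> ^ n" unfolding Cz_def by blast
  have p: "b4_act (\<zeta> ^ k) f = f" if "valid f" for k f
    using that by (induction k) (simp_all add: b4_act_one b4_act_mult b4_act_zeta)
  have "b4_act (t * \<zeta> ^ m) f = f" unfolding t by (rule p[OF v])
  then show ?thesis by (simp add: b4_act_mult[OF v] p valid_b4_act[OF v])
qed

lemma b4_act_ceq: "g \<approx> h \<Longrightarrow> valid f \<Longrightarrow> b4_act g f = b4_act h f"
  unfolding ceq_def by (auto simp: b4_act_mult b4_act_Cz valid_b4_act)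

text \<open>\<open>E i\<close> is the half-turn about the point \<open>mid i + \<i>\<close> of the hyperbolic plane. It maps the outside of
  the interval of radius 1 about \<open>mid i\<close> into that interval, and the three intervals are disjoint.\<close>

fun mid :: "tri \<Rightarrow> int" where "mid T0 = 0" | "mid T1 = 2" | "mid T2 = 4"

definition E :: "tri \<Rightarrow> mat" where "E i = Mat (mid i) (- (mid i * mid i) - 1) 1 (- mid i)"

abbreviation J :: "tri list \<Rightarrow> mat" where "J \<equiv> ev E"

lemma E_square: "E i * E i = - 1"
  by (simp add: E_def one_mat_def algebra_simps power2_eq_square)

lemma det_J [simp]: "det (J w) = 1"
  by (induction w) (simp_all add: E_def algebra_simps power2_eq_square)

text \<open>The first column stands for the point \<open>col1 / col2\<close> of the projective line,
  the image of infinity.\<close>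

fun col1 :: "mat \<Rightarrow> int" and col2 :: "mat \<Rightarrow> int" where
  "col1 (Mat p r q s) = p" | "col2 (Mat p r q s) = q"

lemma col_E: "col2 (E i * x) = col1 x - mid i * col2 x"
  "col1 (E i * x) - mid i * col2 (E i * x) = - col2 x"
  by (cases x; simp add: E_def algebra_simps power2_eq_square)+

lemma col_uminus [simp]: "col1 (- x) = - col1 x" "col2 (- x) = - col2 x"
  by (cases x; simp)+

lemma mid_dist: "i \<noteq> j \<Longrightarrow> \<bar>mid i - mid j\<bar> \<ge> 2"
  by (cases i; cases j) simp_all

section \<open>Ping-pong on the projective line\<close>

lemma cone_disjoint:
  assumes "i \<noteq> j" "\<bar>p - mid i * q\<bar> < \<bar>q\<bar>" shows "\<bar>q\<bar> < \<bar>p - mid j * q\<bar>"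
proof -
  have "\<bar>mid i - mid j\<bar> * \<bar>q\<bar> \<ge> 2 * \<bar>q\<bar>"
    using mid_dist[OF assms(1)] by (intro mult_right_mono) auto
  moreover have "(p - mid j * q) - (p - mid i * q) = (mid i - mid j) * q"
    by (simp add: algebra_simps)
  then have "\<bar>mid i - mid j\<bar> * \<bar>q\<bar> \<le> \<bar>p - mid j * q\<bar> + \<bar>p - mid i * q\<bar>"
    by (metis abs_mult abs_triangle_ineq4)
  ultimately show ?thesis using assms(2) by linarith
qed

text \<open>By induction the tail sends infinity into the interval of its own first letter. That
  interval lies outside the one about \<open>mid i\<close>, so \<open>E i\<close> maps the point
  into the latter.\<close>

lemma ping_pong:
  assumes "distinct_adj (i # w)"
  shows "\<bar>col1 (J (i # w)) - mid i * col2 (J (i # w))\<bar> < \<bar>col2 (J (i # w))\<bar>"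
  using assms
proof (induction w arbitrary: i)
  case Nil
  show ?case by (simp add: E_def)
next
  case (Cons j w)
  have "\<bar>col1 (J (j # w)) - mid j * col2 (J (j # w))\<bar> < \<bar>col2 (J (j # w))\<bar>"
    by (rule Cons.IH) (use Cons.prems in simp)
  then have "\<bar>col2 (J (j # w))\<bar> < \<bar>col1 (J (j # w)) - mid i * col2 (J (j # w))\<bar>"
    by (rule cone_disjoint[rotated]) (use Cons.prems in auto)
  then show ?case
    using col_E(2)[of i "J (j # w)"]
    by (simp only: ev_simps(2)[of E i "j # w"] col_E(1) abs_minus_cancel)
qed

text \<open>The interval containing the image of infinity identifies the first letter, which is then
  cancelled. A sign does not change this image.\<close>

lemma J_injective:
  assumes "distinct_adj u" "distinct_adj v" "J u = J v \<or> J u = - J v"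
  shows "u = v"
  using assms
proof (induction u arbitrary: v)
  case Nil
  show ?case
  proof (cases v)
    case (Cons j v')
    have "col2 1 = col2 (J v) \<or> col2 1 = col2 (- J v)" using Nil(3) by (metis ev_simps(1))
    then have "col2 (J v) = 0" by (simp add: one_mat_def)
    then show ?thesis using ping_pong[of j v'] Nil(2) Cons by simp
  qed simp
next
  case (Cons i u)
  note pi = ping_pong[OF Cons.prems(1)]
  show ?case
  proof (cases v)
    case Nil
    then have "col2 (J (i # u)) = 0" using Cons.prems(3) by (auto simp: one_mat_def)
    then show ?thesis using pi by simp
  next
    case v: (Cons j v')
    have c: "(col1 (J (i # u)) = col1 (J v) \<and> col2 (J (i # u)) = col2 (J v)) \<or>
      (col1 (J (i # u)) = - col1 (J v) \<and> col2 (J (i # u)) = - col2 (J v))"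
      using Cons.prems(3) by (metis col_uminus)
    have vi: "\<bar>col1 (J v) - mid i * col2 (J v)\<bar> < \<bar>col2 (J v)\<bar>"
      using c
    proof
      assume "col1 (J (i # u)) = col1 (J v) \<and> col2 (J (i # u)) = col2 (J v)"
      then show ?thesis using pi by metis
    next
      assume h: "col1 (J (i # u)) = - col1 (J v) \<and> col2 (J (i # u)) = - col2 (J v)"
      have "\<bar>- col1 (J v) - mid i * - col2 (J v)\<bar> < \<bar>- col2 (J v)\<bar>" using pi h by metis
      moreover have "- col1 (J v) - mid i * - col2 (J v) = - (col1 (J v) - mid i * col2 (J v))" by simp
      ultimately show ?thesis by (metis abs_minus_cancel)
    qed
    have ij: "i = j"
    proof (rule ccontr)
      assume "i \<noteq> j"
      then show False using cone_disjoint[OF _ vi, of j] ping_pong[of j v'] v Cons.prems(2) by auto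
    qed
    have dE: "det (E i) = 1" by (simp add: E_def algebra_simps power2_eq_square)
    have "E i * J u = E i * J v' \<or> E i * J u = E i * (- J v')"
      using Cons.prems(3) v ij by simp
    then have "J u = J v' \<or> J u = - J v'" by (simp only: mat_left_cancel[OF dE])
    then have "u = v'" using Cons.IH Cons.prems(1,2) v by (auto dest: distinct_adj_ConsD)
    then show ?thesis using v ij by simp
  qed
qed

text \<open>Congruent braids act alike on the triple of the matrices \<open>E\<close>, so
  \<open>adj (J v) * J u\<close> commutes with every \<open>E j\<close>. Since \<open>E T0\<close>
  and \<open>E T1\<close> do not commute, it is scalar by \<open>mat_commutant\<close>.\<close>

lemma om_ceq_J:
  assumes "om u \<approx> om v" shows "J u = J v \<or> J u = - J v"
proof -
  let ?f = "(E T0, E T1, E T2)"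
  have s: "sel ?f = E" by (rule ext) (metis sel.simps tri.exhaust)
  have v: "valid ?f" by (simp add: E_square)
  let ?g = "sel (b4_act (om u) ?f)"
  have 1: "J u * E j = ?g j * J u" for j using b4_act_om[OF v, of u j] unfolding s .
  have 2: "J v * E j = ?g j * J v" for j
    using b4_act_om[OF v, of v j] unfolding s b4_act_ceq[OF assms v] .
  let ?k = "adj (J v) * J u"
  have 3: "adj (J v) * ?g j = E j * adj (J v)" for j
  proof -
    have "adj (J v) * (J v * E j) * adj (J v) = adj (J v) * (?g j * J v) * adj (J v)" by (simp only: 2)
    then have "(adj (J v) * J v) * E j * adj (J v) = adj (J v) * ?g j * (J v * adj (J v))"
      by (simp only: mult.assoc)
    then show ?thesis by (simp add: adj_left adj_right)
  qed
  have "E j * ?k = ?k * E j" for j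
    using 1[of j] 3[of j] by (metis mult.assoc)
  moreover have "E T0 * E T1 \<noteq> E T1 * E T0" by (simp add: E_def)
  ultimately have "?k = 1 \<or> ?k = - 1" using mat_commutant[of "E T0" ?k "E T1"] by fastforce
  moreover have "J u = J v * ?k" by (simp add: adj_right flip: mult.assoc)
  ultimately show ?thesis by auto
qed

text \<open>Modulo the centre, the elements \<open>om w\<close> thus form the free product of three
  groups of order 2.\<close>

lemma om_ceq_reduced: "om u \<approx> om v \<longleftrightarrow> red u = red v"
proof
  assume "om u \<approx> om v"
  then have "om (red u) \<approx> om (red v)" using om_red ceq_sym ceq_trans by blast
  then show "red u = red v" using J_injective om_ceq_J distinct_adj_red by blast
next
  assume "red u = red v"
  then show "om u \<approx> om v" using om_red[of u] om_red[of v] ceq_sym ceq_trans by metis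
qed

lemma J_ceq_om: "J u = J v \<or> J u = - J v \<Longrightarrow> om u \<approx> om v"
proof -
  assume h: "J u = J v \<or> J u = - J v"
  obtain m n where "J u = (- 1) ^ m * J (red u)" "J v = (- 1) ^ n * J (red v)"
    using red_length[of E, OF E_square] by metis
  then have "J (red u) = J (red v) \<or> J (red u) = - J (red v)"
    using h by (cases "even m"; cases "even n"; simp; metis minus_minus)
  then show ?thesis unfolding om_ceq_reduced using J_injective distinct_adj_red by blast
qed

text \<open>Between words of equal length the sign ambiguity in \<open>om_ceq_J\<close> disappears, because each
  cancellation contributes one sign and removes two letters.\<close>

lemma om_ceq_J_exact:
  assumes "om u \<approx> om v" "length u = length v" shows "J u = J v"
proof -
  obtain m where m: "length u = length (red u) + 2 * m" "J u = (- 1) ^ m * J (red u)"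
    using red_length[of E u, OF E_square] by blast
  obtain n where n: "length v = length (red v) + 2 * n" "J v = (- 1) ^ n * J (red v)"
    using red_length[of E v, OF E_square] by blast
  have r: "red u = red v" using assms(1) by (simp only: om_ceq_reduced)
  then have "m = n" using m(1) n(1) assms(2) by simp
  then show ?thesis using m(2) n(2) r by simp
qed

text \<open>\<open>mat_commutant\<close> is pulled back along \<open>J\<close>. The words compared
  have equal lengths, so no signs intervene, and equal exponent sums turn the final congruence into
  an equality.\<close>

lemma centralizer_commutative:
  assumes "g \<approx> om u" "h \<approx> om v" "n \<approx> om w" "n \<notin> Cz" "g * n = n * g" "h * n = n * h"
  shows "g * h = h * g"
proof -
  have comm: "J x * J w = J w * J x" if "k \<approx> om x" "k * n = n * k" for k x
  proof -
    have "om (x @ w) \<approx> k * n" using ceq_mult[OF that(1) assms(3)] ceq_sym by simp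
    also have "k * n \<approx> om (w @ x)" using ceq_mult[OF assms(3) that(1)] that(2) by simp
    finally have "J (x @ w) = J (w @ x)" by (rule om_ceq_J_exact) simp
    then show ?thesis by simp
  qed
  have "J w \<noteq> 1 \<and> J w \<noteq> - 1"
  proof (rule ccontr)
    assume "\<not> (J w \<noteq> 1 \<and> J w \<noteq> - 1)"
    then have "om w \<approx> om []" by (intro J_ceq_om) auto
    then have "n \<approx> 1" using assms(3) ceq_trans by simp
    then show False using assms(4) by (simp add: ceq_one_iff)
  qed
  then have "J u * J v = J v * J u"
    using mat_commutant comm assms(1,2,5,6) det_J by metis
  then have "om (u @ v) \<approx> om (v @ u)" by (intro J_ceq_om) simp
  then have "om u * om v \<approx> om v * om u" by simp
  then have "g * h \<approx> h * g"
    using ceq_mult[OF assms(1,2)] ceq_mult[OF assms(2,1)] ceq_sym ceq_trans by blast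
  then show ?thesis by (rule ceq_expo) (simp add: mult.commute)
qed

text \<open>The word \<open>w @ w\<close> collapses after \<open>length w\<close> cancellations, an
  even number because the matrix is 1. So \<open>J w\<close> squares to \<open>1\<close>, not
  \<open>- 1\<close>, and is scalar.\<close>

lemma torsion_free:
  assumes "sl_rep u = 1" "expo u = 1" "u * u \<in> Cz" shows "u = 1"
proof -
  obtain w where w: "u \<approx> om w" using sl_rep_kernel assms(1) by blast
  have ev: "even (length w)"
  proof (rule ccontr)
    assume "odd (length w)"
    then have "sl_rep u = - 1" using ceq_sl_rep[OF w] by (simp add: sl_rep_om)
    then show False using assms(1) by (simp add: one_mat_def)
  qed
  have "om (w @ w) \<approx> u * u" using ceq_mult[OF w w] ceq_sym by simp
  also have "u * u \<approx> om []" using assms(3) by (simp add: ceq_one_iff)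
  finally have "om (w @ w) \<approx> om []" .
  then have r: "red (w @ w) = []" unfolding om_ceq_reduced by simp
  obtain n where "length (w @ w) = length (red (w @ w)) + 2 * n" "J (w @ w) = (- 1) ^ n * J (red (w @ w))"
    using red_length[of E "w @ w", OF E_square] by blast
  moreover from this have "n = length w" using r by simp
  ultimately have "J w * J w = 1" using r ev by simp
  then have "J w = 1 \<or> J w = - 1" by (rule mat_square_one) simp
  then have "om w \<approx> om []" by (intro J_ceq_om) simp
  then have "u \<approx> 1" using ceq_trans[OF w, of 1] by simp
  then have "u \<in> Cz" by (simp only: ceq_one_iff)
  then show ?thesis using expo_Cz assms(2) by blast
qed

section \<open>Words in three involutions\<close>

lemma om_rev: "om (rev w) \<approx> ginv (om w)"
proof (induction w)
  case (Cons i w)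
  have "eps i * eps i \<approx> 1" by (simp only: eps_square ceq_one_iff Cz_zeta1)
  then have "eps i \<approx> ginv (eps i)" using ceq_left[of "eps i * eps i" 1 "ginv (eps i)"] by simp
  then show ?case using ceq_mult[OF Cons] by simp
qed simp

lemma even_length_iff: "g \<approx> om w \<Longrightarrow> sl_rep g = 1 \<Longrightarrow> even (length w)"
  "g \<approx> om w \<Longrightarrow> sl_rep g = - 1 \<Longrightarrow> odd (length w)"
proof -
  have ne: "(1 :: mat) \<noteq> - 1" by (simp add: one_mat_def)
  show "g \<approx> om w \<Longrightarrow> sl_rep g = 1 \<Longrightarrow> even (length w)"
    "g \<approx> om w \<Longrightarrow> sl_rep g = - 1 \<Longrightarrow> odd (length w)"
    using ceq_sl_rep[of g "om w"] sl_rep_om[of w] ne by (cases "even (length w)"; simp)+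
qed

lemma reduced_representative:
  assumes "sl_rep g = 1 \<or> sl_rep g = - 1"
  obtains w where "g \<approx> om w" "distinct_adj w"
  using sl_rep_kernel[OF assms] om_red distinct_adj_red ceq_trans by metis

lemma odd_palindrome:
  assumes "rev w = w" "odd (length w)" obtains l i where "w = l @ i # rev l"
proof -
  obtain n where n: "length w = 2 * n + 1" using assms(2) by (auto elim: oddE)
  have "w = take n w @ w ! n # drop (Suc n) w" using n by (simp add: id_take_nth_drop)
  moreover have "drop (Suc n) w = rev (take n w)"
    using rev_take[of n w] n assms(1) by simp
  ultimately show ?thesis using that by metis
qed

text \<open>An involution equals its inverse, so its reduced word is a palindrome. The matrix
  \<open>- 1\<close> makes the length odd, and the middle letter is the conjugate sought.\<close>

lemma involution_conj:
  assumes "sl_rep g = - 1" "g * g \<in> Cz"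
  obtains l i where "g \<approx> om l * eps i * ginv (om l)"
proof -
  obtain w where w: "g \<approx> om w" "distinct_adj w"
    using reduced_representative[of g] assms(1) by blast
  have "om w * om w \<approx> g * g" using ceq_mult[OF w(1) w(1)] by (rule ceq_sym)
  also have "g * g \<approx> om w * ginv (om w)" using assms(2) by (simp add: ceq_one_iff)
  finally have "om w \<approx> ginv (om w)" by (rule ceq_cancel_left)
  also have "\<dots> \<approx> om (rev w)" by (rule ceq_sym[OF om_rev])
  finally have "red w = red (rev w)" by (simp only: om_ceq_reduced)
  then have "rev w = w" using w(2) red_reduced distinct_adj_rev by metis
  then obtain l i where l: "w = l @ i # rev l"
    using odd_palindrome even_length_iff(2)[OF w(1) assms(1)] by metis
  have "om w \<approx> om l * (eps i * ginv (om l))"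
    unfolding l by (simp add: ceq_left om_rev)
  with w(1) have "g \<approx> om l * eps i * ginv (om l)"
    unfolding mult.assoc by (rule ceq_trans)
  then show ?thesis by (rule that)
qed

lemma red_parity: "even (count_list (red w) x) \<longleftrightarrow> even (count_list w x)"
proof (induction w)
  case (Cons i w)
  then show ?case by (cases "red w") auto
qed simp

lemma om_ceq_parity: "om u \<approx> om v \<Longrightarrow> even (count_list u x) \<longleftrightarrow> even (count_list v x)"
  unfolding om_ceq_reduced by (metis red_parity)

text \<open>\<open>E T0\<close> is a rotation by a right angle, so its integer commutant is the ring
  of Gaussian integers. The units are \<open>1\<close> and \<open>E T0\<close> up to sign, and even
  length excludes the latter.\<close>

lemma commute_eps0:
  assumes "om (T0 # w) \<approx> om (w @ [T0])" "even (length w)" shows "om w \<approx> 1"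
proof -
  have c: "E T0 * J w = J w * E T0" using om_ceq_J_exact[OF assms(1)] by simp
  obtain a b c d where m: "J w = Mat a b c d" by (cases "J w")
  have "E T0 * Mat a b c d = Mat (- c) (- d) a b" "Mat a b c d * E T0 = Mat b (- a) d (- c)"
    by (simp_all add: E_def)
  then have "Mat (- c) (- d) a b = Mat b (- a) d (- c)" using c unfolding m by metis
  then have bc: "b = - c" "a = d" unfolding mat.inject by blast+
  have "a * a + c * c = 1" using det_J[of w] unfolding m bc by simp
  then have sq: "a\<^sup>2 + c\<^sup>2 = 1" by (simp add: power2_eq_square)
  then have le: "a\<^sup>2 \<le> 1" "c\<^sup>2 \<le> 1" using zero_le_power2[of a] zero_le_power2[of c] by linarith+
  then have "\<bar>a\<bar> \<le> 1" "\<bar>c\<bar> \<le> 1" by (simp_all only: abs_square_le_1)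
  then have "a = -1 \<or> a = 0 \<or> a = 1" "c = -1 \<or> c = 0 \<or> c = 1" by arith+
  then have "J w = J [] \<or> J w = - J [] \<or> J w = J [T0] \<or> J w = - J [T0]"
    using sq unfolding m bc by (elim disjE) (simp_all add: E_def one_mat_def)
  then have "om w \<approx> om [] \<or> om w \<approx> om [T0]" using J_ceq_om by blast
  moreover have "\<not> om w \<approx> om [T0]"
  proof
    assume "om w \<approx> om [T0]"
    moreover have "sl_rep (om w) = 1" using assms(2) by (simp add: sl_rep_om)
    ultimately have "even (length [T0])" by (rule even_length_iff(1))
    then show False by simp
  qed
  ultimately show ?thesis by simp
qed

text \<open>\<open>t2\<close> is conjugation by \<open>(\<gamma>\<beta>)\<^sup>2\<close>. It multiplies the first factor of a normal form
  \<open>p\<^sub>0 T2 p\<^sub>1 T2 \<dots> p\<^sub>r\<close> in the free product of \<open>\<langle>T0, T1\<rangle>\<close> and \<open>\<langle>T2\<rangle>\<close> on the right by \<open>T0 T1\<close>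
  whenever \<open>r > 0\<close>.\<close>

fun t2 :: "tri \<Rightarrow> tri list" where
  "t2 T0 = [T0]" | "t2 T1 = [T1]" | "t2 T2 = [T0, T1, T2, T1, T0]"

abbreviation pre :: "tri list \<Rightarrow> tri list" where "pre w \<equiv> takeWhile (\<lambda>i. i \<noteq> T2) w"

lemma pre_rcons: "i \<noteq> T2 \<Longrightarrow> pre (rcons i w) = rcons i (pre w)"
  by (cases w) auto

lemma pre_reduced: "distinct_adj w \<Longrightarrow> distinct_adj (pre w)"
  by (metis takeWhile_dropWhile_id distinct_adj_appendD1)

lemma red_conj_nonempty:
  assumes "distinct_adj p" "p \<noteq> []" shows "red ([T1, T0] @ p @ [T0, T1]) \<noteq> []"
proof
  assume "red ([T1, T0] @ p @ [T0, T1]) = []"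
  then have "om ([T1, T0] @ p @ [T0, T1]) \<approx> om ([T1, T0] @ [T0, T1])"
    unfolding om_ceq_reduced by simp
  then have "om [T1, T0] * (om p * om [T0, T1]) \<approx> om [T1, T0] * (1 * om [T0, T1])"
    by (simp add: mult.assoc)
  then have "om p \<approx> om []" using ceq_cancel_left ceq_cancel_right by (metis ev_simps(1))
  then have "red p = red []" by (simp only: om_ceq_reduced)
  then show False using assms red_reduced[of p] by simp
qed

lemma pre_t2:
  assumes "distinct_adj w" "T2 \<in> set w"
  shows "pre (red (concat (map t2 w))) = red (pre w @ [T0, T1])"
  using assms
proof (induction w)
  case (Cons i w)
  show ?case
  proof (cases "i = T2")
    case False
    then have "T2 \<in> set w" "distinct_adj w" using Cons.prems by (auto dest: distinct_adj_ConsD)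
    moreover have "t2 i = [i]" using False by (cases i) auto
    ultimately show ?thesis using Cons.IH False by (simp add: pre_rcons)
  next
    case True
    have w: "distinct_adj w" "w = [] \<or> hd w \<noteq> T2"
      using Cons.prems True by (cases w; auto)+
    let ?z = "rcons T1 (rcons T0 (red (concat (map t2 w))))"
    \<comment> \<open>This keeps the inner \<open>T2\<close> of \<open>t2 T2\<close> from
      cancelling, so the first factor of the result is \<open>T0 T1\<close>.\<close>
    have "?z = [] \<or> hd ?z \<noteq> T2"
    proof (cases "T2 \<in> set w")
      case T: True
      have pz: "pre ?z = red ([T1, T0] @ pre w @ [T0, T1])"
        using Cons.IH[OF w(1) T] by (simp add: pre_rcons)
      have "pre w \<noteq> []" using w T by (cases w) auto
      then have "pre ?z \<noteq> []" unfolding pz by (rule red_conj_nonempty[OF pre_reduced[OF w(1)]])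
      then show ?thesis by (cases ?z) (auto split: if_splits)
    next
      case F: False
      have "map t2 w = map (\<lambda>i. [i]) w"
        using F by (intro map_cong HOL.refl) (metis t2.simps tri.exhaust)
      moreover have "concat (map (\<lambda>i. [i]) w) = w" by (induction w) auto
      ultimately have "concat (map t2 w) = w" by (simp only:)
      then have z: "?z = rcons T1 (rcons T0 w)" using red_reduced[OF w(1)] by simp
      have "T2 \<notin> set ?z" unfolding z using F by (cases w; cases "tl w"; auto)
      then show ?thesis by (cases ?z) auto
    qed
    then have "rcons T2 ?z = T2 # ?z" by (cases ?z) auto
    then show ?thesis using True by (simp add: pre_rcons)
  qed
qed simp

text \<open>If \<open>T2\<close> occurred, the first factor would be unchanged under right
  multiplication by \<open>T0 T1\<close>, which is nontrivial.\<close>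

lemma t2_fixed:
  assumes "distinct_adj w" "red (concat (map t2 w)) = w" shows "T2 \<notin> set w"
proof
  assume "T2 \<in> set w"
  then have "pre w = red (pre w @ [T0, T1])" using pre_t2[OF assms(1)] assms(2) by simp
  then have "om (pre w @ [T0, T1]) \<approx> om (pre w @ [])"
    unfolding om_ceq_reduced using red_reduced[OF pre_reduced[OF assms(1)]] by simp
  then have "om (pre w) * om [T0, T1] \<approx> om (pre w) * om []" by (simp only: ev_simps)
  then have "om [T0, T1] \<approx> om []" by (rule ceq_cancel_left)
  then have "red [T0, T1] = red []" by (simp only: om_ceq_reduced)
  then show False by simp
qed

lemma inj_rot: "inj rot"
  by (rule injI) (metis rot.simps tri.exhaust tri.distinct)

lemma hd_last_map_rot: "w \<noteq> [] \<Longrightarrow> hd (map rot w) = rot (hd w)" "w \<noteq> [] \<Longrightarrow> last (map rot w) = rot (last w)"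
  by (simp_all add: hd_map last_map)

text \<open>The condition on the end letters prevents cancellation at both junctions, so the product
  is already reduced.\<close>

lemma rot_product_reduced:
  assumes "distinct_adj w" "w \<noteq> []" "last w \<noteq> rot (hd w)"
  shows "\<not> om (w @ map rot w @ map rot (map rot w)) \<approx> 1"
proof
  assume h: "om (w @ map rot w @ map rot (map rot w)) \<approx> 1"
  have m: "distinct_adj (map rot w)" "distinct_adj (map rot (map rot w))"
    using assms(1) by (simp_all only: distinct_adj_map_iff[OF inj_on_subset[OF inj_rot subset_UNIV]])
  have "rot (last w) \<noteq> rot (rot (hd w))" using assms(3) inj_rot by (simp add: inj_eq)
  then have "distinct_adj (w @ map rot w @ map rot (map rot w))"
    using assms m by (simp add: distinct_adj_append_iff hd_last_map_rot del: map_map)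
  moreover have "red (w @ map rot w @ map rot (map rot w)) = red []"
    unfolding om_ceq_reduced[symmetric] ev_simps(1) by (rule h)
  ultimately show False using red_reduced assms(2) by fastforce
qed

text \<open>The last hypothesis says that the cube of \<open>om w * \<gamma>\<close> is central.
  Cancellation at the junctions forces \<open>w\<close> to run from \<open>T0\<close> to
  \<open>T1\<close>; the middle part satisfies the same equation, but its end letters would have to
  be \<open>T1\<close> and \<open>T0\<close>, which do not cancel.\<close>

lemma rot_product_trivial:
  assumes "distinct_adj w" "T2 \<notin> set w" "om (w @ map rot w @ map rot (map rot w)) \<approx> 1"
  shows "w = [] \<or> w = [T0, T1]"
proof (cases "w = []")
  case False
  then have hl: "last w = rot (hd w)" using rot_product_reduced assms by blast
  have T2: "hd w \<noteq> T2" "last w \<noteq> T2" using assms(2) False by (metis hd_in_set, metis last_in_set)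
  then have h: "hd w = T0" "last w = T1" using hl by (cases "hd w"; simp)+
  obtain v where v: "w = T0 # v" using h(1) False by (cases w) auto
  have "v \<noteq> []" using h v by auto
  then obtain m where m: "w = T0 # m @ [T1]" using v h(2) by (metis append_butlast_last_id last_ConsR)
  let ?r = "map rot m" and ?s = "map rot (map rot m)"
  have q: "eps i * (eps i * x) \<approx> x" for i x
  proof -
    have "eps i * (eps i * x) = x * \<zeta>" by (simp add: zeta_commute[symmetric] eps_square flip: mult.assoc)
    then show ?thesis by (simp add: ceq_mult_Cz)
  qed
  \<comment> \<open>The three copies run from \<open>T0\<close> to \<open>T1\<close>, from
    \<open>T1\<close> to \<open>T2\<close> and from \<open>T2\<close> to \<open>T0\<close>, so equal
    letters meet at both junctions and at the two outer ends.\<close>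
  have "om (w @ map rot w @ map rot (map rot w)) = eps T0 * (om m * (eps T1 * (eps T1 * (om ?r *
      (eps T2 * (eps T2 * (om ?s * eps T0)))))))"
    unfolding m by (simp add: mult.assoc del: eps.simps)
  also have "\<dots> \<approx> eps T0 * (om m * (om ?r * (om ?s * eps T0)))"
    by (intro ceq_left ceq_trans[OF q] ceq_refl)
  finally have "eps T0 * (om m * (om ?r * (om ?s * eps T0))) \<approx> 1"
    using assms(3) ceq_sym ceq_trans by blast
  moreover have "1 \<approx> eps T0 * (1 * eps T0)" using eps_square[of T0] by (simp add: ceq_sym ceq_one_iff del: eps.simps)
  ultimately have "eps T0 * (om (m @ ?r @ ?s) * eps T0) \<approx> eps T0 * (1 * eps T0)"
    using ceq_trans by (simp add: mult.assoc del: eps.simps)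
  then have t: "om (m @ ?r @ ?s) \<approx> 1" using ceq_cancel_left ceq_cancel_right by blast
  have "m = []"
  proof (rule ccontr)
    assume ne: "m \<noteq> []"
    have d: "distinct_adj m" "hd m \<noteq> T0" "last m \<noteq> T1" "T2 \<notin> set m"
      using assms(1,2) ne unfolding m by (auto simp: distinct_adj_Cons distinct_adj_append_iff)
    then have "hd m \<noteq> T2" "last m \<noteq> T2" using ne by (metis hd_in_set, metis last_in_set)
    then have "hd m = T1" "last m = T0" using d by (cases "hd m"; cases "last m"; simp)+
    then have "last m \<noteq> rot (hd m)" by simp
    then show False using rot_product_reduced d(1) ne t by blast
  qed
  then show ?thesis using m by simp
qed simp

section \<open>Braid triples\<close>

definition autom :: "(b4 \<Rightarrow> b4) \<Rightarrow> bool" where "autom f \<longleftrightarrow> is_hom f \<and> bij f"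

text \<open>The triples obtained from the identity by a transvection with central \<open>t\<close>
  followed by an automorphism.\<close>

definition standard :: "b4 \<Rightarrow> b4 \<Rightarrow> b4 \<Rightarrow> bool" where
  "standard a b c \<longleftrightarrow>
    (\<exists>f. autom f \<and> (\<exists>t\<in>Cz. a = f (s1 * t) \<and> b = f (s2 * t) \<and> c = f (s3 * t)))"

lemma autom_inv: "autom f \<Longrightarrow> autom (inv_into UNIV f)"
proof -
  assume "autom f"
  then have f: "is_hom f" "bij f" by (auto simp: autom_def)
  let ?g = "inv_into UNIV f"
  have i: "f (?g x) = x" "?g (f x) = x" for x
    using f(2) by (simp_all add: bij_is_surj surj_f_inv_f bij_is_inj)
  have "?g (x * y) = ?g x * ?g y" for x y
    using i(2)[of "?g x * ?g y"] by (simp add: is_homD(2)[OF f(1)] i(1))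
  moreover have "?g 1 = 1" using i(2)[of 1] by (simp add: is_homD(1)[OF f(1)])
  ultimately show ?thesis using f by (simp add: autom_def is_hom_def bij_imp_bij_inv)
qed

lemma autom_comp: "autom f \<Longrightarrow> autom g \<Longrightarrow> autom (f \<circ> g)"
  by (auto simp: autom_def is_hom_def intro: bij_comp)

lemma autom_conj: "autom (\<lambda>x. g * x * ginv g)"
proof -
  have "bij (\<lambda>x. g * x * ginv g)"
    by (rule o_bij[of "\<lambda>x. ginv g * x * g"]) (auto simp: mult.assoc fun_eq_iff)
  then show ?thesis by (simp add: autom_def is_hom_def mult.assoc)
qed

lemma autom_mirror: "autom mirror"
  using mirror(1) by (auto simp: autom_def intro!: o_bij[of mirror])

lemma standard_autom:
  assumes "autom f" "standard (f a) (f b) (f c)" shows "standard a b c"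
proof -
  obtain g t where g: "autom g" "t \<in> Cz" "f a = g (s1 * t)" "f b = g (s2 * t)" "f c = g (s3 * t)"
    using assms(2) unfolding standard_def by blast
  let ?h = "inv_into UNIV f \<circ> g"
  have i: "inv_into UNIV f (f x) = x" for x using assms(1) by (simp add: autom_def bij_is_inj)
  have "autom ?h" using autom_comp autom_inv assms(1) g(1) by blast
  moreover have "a = ?h (s1 * t)" "b = ?h (s2 * t)" "c = ?h (s3 * t)"
    by (simp_all add: i flip: g(3-5))
  ultimately show ?thesis unfolding standard_def using g(2) by blast
qed

lemma braid_triple_autom:
  assumes "braid_triple a b c" "is_hom f" shows "braid_triple (f a) (f b) (f c)"
  using assms unfolding braid_triple_def by (metis is_homD(2))

lemma sl_rep_conj: "sl_rep (g * x * ginv g) = sl_rep g * sl_rep x * adj (sl_rep g)"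
  by simp

lemma tr_sl_rep_conj: "tr (sl_rep (g * x * ginv g)) = tr (sl_rep x)"
  by (simp add: mult.assoc tr_mult_commute[of "sl_rep g"] adj_left)

lemma (in mult_group) inverting_square_commute:
  assumes "n * u = ginv u * n" shows "u * (n * n) = n * n * u"
proof -
  have "u * n = u * (n * u) * ginv u" by (simp add: mult.assoc)
  then have "u * n = n * ginv u" unfolding assms by (simp add: mult.assoc)
  then have "u * n * n = n * (ginv u * n)" by (simp only: mult.assoc)
  then show ?thesis unfolding assms[symmetric] by (simp only: mult.assoc)
qed

locale b4_triple = braid_triple a b c for a b c :: b4
begin

abbreviation "e \<equiv> bet * bet"
abbreviation "u \<equiv> a * ginv c"

lemma sl_triple: "braid_triple (sl_rep a) (sl_rep b) (sl_rep c)"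
  by (rule braid_triple_autom[OF braid_triple_axioms sl_rep_hom])

lemma sl_a_c: "sl_rep a = sl_rep c"
  and sl_a_b: "sl_rep a = sl_rep b \<or> tr (sl_rep a * sl_rep b) = 1"
  using mat_braid_triple[OF sl_triple] by simp_all

lemma expo_eq: "expo b = expo a" "expo c = expo a"
proof -
  have "expo (a * b * a) = expo (b * a * b)" "expo (b * c * b) = expo (c * b * c)"
    using aba bcb by simp_all
  then show "expo b = expo a" "expo c = expo a" by simp_all
qed

lemma sl_u: "sl_rep u = 1" and expo_u: "expo u = 1"
  by (simp_all add: sl_a_c adj_right expo_eq)

lemma e_a: "e * a = c * e" and e_c: "e * c = a * e"
  using bet2_a bet2_c by (simp_all only: mult.assoc)

lemma e_u: "e * u = ginv u * e"
proof -
  have "ginv a * (e * c) * ginv c = ginv a * (a * e) * ginv c" by (simp only: e_c)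
  then have ec: "e * ginv c = ginv a * e" by (simp add: mult.assoc)
  have "e * u = (e * a) * ginv c" by (simp only: mult.assoc)
  also have "\<dots> = c * (e * ginv c)" unfolding e_a by (simp only: mult.assoc)
  also have "\<dots> = ginv u * e" unfolding ec by (simp add: mult.assoc)
  finally show ?thesis .
qed

lemma a_u: "a * u = u * a"
proof -
  have "ginv c * a = a * ginv c" by (rule ginv_commute[OF ac, symmetric])
  then show ?thesis by (simp only: mult.assoc)
qed

text \<open>Later arguments show that \<open>e\<close>, or a variant of it, both commutes with
  \<open>u\<close> and inverts it; \<open>torsion_free\<close> then leaves only
  \<open>u = 1\<close>.\<close>

lemma u_trivial: "ginv u = u \<Longrightarrow> a = c"
proof -
  assume "ginv u = u"
  then have "u * u = 1" by (metis ginv_left)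
  then have "u = 1" using torsion_free[OF sl_u expo_u] Cz_one by metis
  then show "a = c" by (metis ginv_left mult.assoc mult_1_left mult_1_right)
qed

lemma sl_cyclic: "sl_rep a = sl_rep b \<Longrightarrow> a = c"
proof (rule ccontr)
  assume ab: "sl_rep a = sl_rep b" and "a \<noteq> c"
  \<comment> \<open>\<open>e\<close> is a product of six generators, so dividing by
    \<open>a ^ 6\<close> makes both the matrix and the exponent sum trivial. As \<open>a\<close>
    commutes with \<open>u\<close>, the quotient still inverts \<open>u\<close>.\<close>
  define n where "n = e * ginv (a ^ 6)"
  have se: "sl_rep e = sl_rep a ^ 6"
    by (simp add: bet_def ab[symmetric] sl_a_c[symmetric] numeral_eq_Suc mult.assoc)
  have n1: "sl_rep n = 1"
    unfolding n_def sl_rep_simps(2)[of e] se sl_rep_ginv sl_rep_simps(3)[symmetric]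
    by (rule adj_right) (rule det_sl_rep)
  have "expo e = expo a ^ 6" by (simp add: bet_def expo_eq numeral_eq_Suc)
  then have n2: "expo n = 1" by (simp add: n_def)
  have "a ^ 6 * u = u * a ^ 6" by (rule power_commuting_commutes[OF a_u])
  then have "u * ginv (a ^ 6) = ginv (a ^ 6) * u" by (intro ginv_commute) simp
  then have "n * u = e * u * ginv (a ^ 6)" unfolding n_def by (simp only: mult.assoc)
  then have nu: "n * u = ginv u * n" unfolding n_def e_u by (simp only: mult.assoc)
  obtain p where p: "n \<approx> om p" using sl_rep_kernel n1 by blast
  obtain q where q: "u \<approx> om q" using sl_rep_kernel sl_u by blast
  show False
  proof (cases "n * n \<in> Cz")
    case True
    then have "n = 1" using torsion_free n1 n2 by blast
    then have "ginv u = u" using nu by simp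
    then show False using u_trivial \<open>a \<noteq> c\<close> by blast
  next
    case False
    have "u * (n * n) = n * n * u" by (rule inverting_square_commute[OF nu])
    then have "n * u = u * n"
      using centralizer_commutative[OF p q ceq_mult[OF p p, folded ev_simps(3)] False] by (simp only: mult.assoc)
    then have "ginv u = u" using nu by (metis mult_right_cancel_group)
    then show False using u_trivial \<open>a \<noteq> c\<close> by blast
  qed
qed

end

text \<open>Cayley-Hamilton reads \<open>v * v = v - 1\<close> here.\<close>

lemma mat_trace_one_cube: "det v = 1 \<Longrightarrow> tr v = 1 \<Longrightarrow> v * (v * v) = - 1"
proof (cases v)
  case (Mat p q r s)
  assume "det v = 1" "tr v = 1"
  then have s: "s = 1 - p" and "p * s - q * r = 1" using Mat by auto
  then have d: "q * r = p * (1 - p) - 1" unfolding s by simp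
  have "v * v = v - 1" unfolding Mat s using d by (simp add: one_mat_def algebra_simps)
  then show ?thesis by (simp add: right_diff_distrib)
qed

section \<open>Triples with distinct outer members\<close>

locale b4_triple_nontrivial = b4_triple +
  assumes ac_ne: "a \<noteq> c"
begin

lemma tr_ab: "tr (sl_rep a * sl_rep b) = 1"
  using sl_a_b sl_cyclic ac_ne by blast

lemma sl_e: "sl_rep e = - 1"
proof -
  let ?a = "sl_rep a" and ?b = "sl_rep b"
  have "?a * ?b * ?a = ?b * ?a * ?b" using arg_cong[OF aba, of sl_rep] by simp
  then have "?a * ?b * ?a * (?a * ?b * ?a) = ?a * ?b * ?a * (?b * ?a * ?b)" by simp
  also have "\<dots> = (?a * ?b) * ((?a * ?b) * (?a * ?b))" by (simp add: mult.assoc)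
  also have "\<dots> = - 1" using tr_ab by (intro mat_trace_one_cube) simp_all
  finally show ?thesis by (simp add: bet_def sl_a_c[symmetric] mult.assoc)
qed

lemma bet4_e: "bet ^ 4 = e * e"
  by (simp only: bet_pow4 mult.assoc)

text \<open>Both \<open>e\<close> and \<open>u\<close> commute with \<open>e * e\<close>. Were it
  not in \<open>Cz\<close>, they would commute with each other, although \<open>e\<close> inverts
  \<open>u\<close>.\<close>

lemma e_square_central: "e * e \<in> Cz"
proof (rule ccontr)
  assume n: "e * e \<notin> Cz"
  have "sl_rep (e * e) = 1" using sl_e by (simp del: sl_rep_simps add: sl_rep_simps(2)[of e e])
  then obtain w where w: "e * e \<approx> om w" using sl_rep_kernel by blast
  obtain p where p: "e \<approx> om p" using sl_rep_kernel sl_e by blast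
  obtain q where q: "u \<approx> om q" using sl_rep_kernel sl_u by blast
  have "bet ^ 4 * ginv c = ginv c * bet ^ 4" by (rule ginv_commute[OF bet4_c])
  then have "u * bet ^ 4 = bet ^ 4 * u" using bet4_a by (metis mult.assoc)
  then have "e * u = u * e"
    using centralizer_commutative[OF p q w n] unfolding bet4_e by (simp only: mult.assoc)
  then have "ginv u = u" using e_u by (metis mult_right_cancel_group)
  then show False using u_trivial ac_ne by blast
qed

lemma e_conj_eps: obtains l i where "e \<approx> om l * eps i * ginv (om l)"
  using involution_conj sl_e e_square_central by blast

lemma eps_conj: "\<exists>h. eps i = h * (\<beta> * \<beta>) * ginv h"
proof (cases i)
  case T0
  then show ?thesis by (intro exI[of _ 1]) simp
next
  case T1
  then show ?thesis by auto
next
  case T2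
  then show ?thesis by (intro exI[of _ "\<gamma> * \<gamma>"]) (simp add: mult.assoc)
qed

end

text \<open>The value at 1 of the characteristic polynomial is \<open>2 - tr x\<close>.\<close>

lemma mat_fixed_vector:
  assumes "det x = 1" "mat_x x p q = p" "mat_y x p q = q" "p \<noteq> 0 \<or> q \<noteq> 0" shows "tr x = 2"
proof (cases x)
  case (Mat a b c d)
  have h: "(a - 1) * p + b * q = 0" "c * p + (d - 1) * q = 0" "a * d - b * c = 1"
    using assms Mat by (auto simp: algebra_simps)
  have "(2 - a - d) * p = 0" "(2 - a - d) * q = 0" using h by algebra+
  then show ?thesis using assms(4) Mat by auto
qed

text \<open>The parity obstruction: a matrix of determinant and trace 1 has order 3 modulo 2, so it
  cannot fix \<open>(1, 1)\<close>.\<close>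

lemma trace_one_parity:
  assumes "det v = 1" "tr v = 1" "odd (mat_x v 1 1)" "odd (mat_y v 1 1)" shows False
proof (cases v)
  case (Mat p q r s)
  have "s = 1 - p" using assms(2) Mat by simp
  then have "p * (1 - p) - q * r = 1" "odd (p + q)" "odd (r + 1 - p)" using assms Mat by auto
  then have "odd (p * (1 - p) - q * r)" "odd (p + q)" "odd (r + 1 - p)" by auto
  then show False by (auto simp: even_mult_iff)
qed

lemma mat_xy_mult: "mat_x (v * w) p q = mat_x v (mat_x w p q) (mat_y w p q)"
  "mat_y (v * w) p q = mat_y v (mat_x w p q) (mat_y w p q)"
  by (cases v; cases w; simp add: algebra_simps)+

lemma mat_xy_parity:
  "odd p \<Longrightarrow> odd q \<Longrightarrow> even (mat_x v p q) \<longleftrightarrow> even (mat_x v 1 1)"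
  "odd p \<Longrightarrow> odd q \<Longrightarrow> even (mat_y v p q) \<longleftrightarrow> even (mat_y v 1 1)"
  by (cases v; auto)+

text \<open>Compares translation parts in a conjugation by the half-turn through which
  \<open>\<beta> * \<beta>\<close> acts.\<close>

lemma lin_uminus_comm:
  assumes "Aff (- 1) (- 1) (- 1) * f = g * Aff (- 1) (- 1) (- 1)"
  shows "tx f + tx g + 1 = mat_x (lin g) 1 1 \<and> ty f + ty g + 1 = mat_y (lin g) 1 1"
  using assms by (cases f; cases g; cases "lin f"; cases "lin g") (auto simp: one_mat_def)

context b4_triple_nontrivial
begin

text \<open>If the translation part of \<open>u\<close> were trivial, then both \<open>a\<close> and \<open>bet\<close> would fix the vector
  \<open>(1, 1)\<close> modulo 2.\<close>

lemma trace_two_aux: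
  assumes "e \<approx> \<beta> * \<beta>" shows "tr (sl_rep a) = 2"
proof -
  note m = is_homD(2)[OF aff_rep(1)]
  let ?n = "Aff (- 1) (- 1) (- 1)"
  obtain t where t: "t \<in> Cz" "e = \<beta> * \<beta> * t" using assms unfolding ceq_def by blast
  then have e: "aff_rep e = ?n"
    unfolding t(2) m[of _ t] aff_rep_bet2 aff_rep_Cz[OF t(1)] by simp
  have "?n * aff_rep a = aff_rep c * ?n" using arg_cong[OF e_a, of aff_rep] by (simp only: m[of e] m[of c e] e)
  note ca = lin_uminus_comm[OF this]
  have "?n * aff_rep bet = aff_rep bet * ?n" using e m by (metis mult.assoc)
  note bb = lin_uminus_comm[OF this]
  obtain x p q where a: "aff_rep a = Aff x p q" by (cases "aff_rep a")
  obtain y r s where c: "aff_rep c = Aff y r s" by (cases "aff_rep c")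
  have xy: "y = x" "x = sl_rep a" using sl_a_c a c by (simp_all add: sl_rep_def)
  obtain z k l where u: "aff_rep u = Aff z k l" by (cases "aff_rep u")
  have z: "z = 1" using sl_u u by (simp add: sl_rep_def)
  have "aff_rep u * aff_rep c = aff_rep (u * c)" by (rule m[symmetric])
  also have "u * c = a" by (simp add: mult.assoc)
  finally have pr: "p = r + k" "q = s + l" unfolding u a c z by (simp_all add: one_mat_def)
  have "aff_rep u * aff_rep a = aff_rep a * aff_rep u"
    using arg_cong[OF a_u, of aff_rep] unfolding m[of u a] m[of a u] by (rule HOL.sym)
  then have fv: "mat_x x k l = k" "mat_y x k l = l" unfolding u a z by (simp_all add: one_mat_def)
  show ?thesis
  proof (cases "k = 0 \<and> l = 0")
    case False
    then show ?thesis using mat_fixed_vector[OF _ fv] xy by auto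
  next
    case True
    then have "mat_x x 1 1 = 2 * p + 1" "mat_y x 1 1 = 2 * q + 1" using ca pr unfolding a c xy by auto
    then have ox: "odd (mat_x x 1 1)" "odd (mat_y x 1 1)" by simp_all
    have "lin (aff_rep bet) = sl_rep a * sl_rep b * sl_rep a"
      by (simp add: bet_def m sl_rep_def[symmetric] sl_a_c mult.assoc)
    \<comment> \<open>\<open>aff_rep bet\<close> commutes with the half-turn, so its own translation
      enters twice in \<open>lin_uminus_comm\<close>.\<close>
    moreover have "odd (mat_x (lin (aff_rep bet)) 1 1)" "odd (mat_y (lin (aff_rep bet)) 1 1)"
      unfolding bb[THEN conjunct1, symmetric] bb[THEN conjunct2, symmetric] by simp_all
    \<comment> \<open>The matrix of \<open>bet\<close> is A B A, and A preserves
      \<open>(1, 1)\<close> modulo 2, so A B preserves it too.\<close>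
    ultimately have "odd (mat_x (sl_rep a * sl_rep b) 1 1)" "odd (mat_y (sl_rep a * sl_rep b) 1 1)"
      using mat_xy_parity[OF ox] xy by (simp_all add: mat_xy_mult(1)[of "sl_rep a * sl_rep b"] mat_xy_mult(2)[of "sl_rep a * sl_rep b"])
    then show ?thesis using trace_one_parity tr_ab by (metis det_mult det_sl_rep mult_1_left)
  qed
qed

end

lemma b4_triple_nontrivial_autom:
  assumes "b4_triple_nontrivial a b c" "autom f" shows "b4_triple_nontrivial (f a) (f b) (f c)"
proof -
  interpret b4_triple_nontrivial a b c by fact
  have "f a \<noteq> f c" using ac_ne assms(2) by (auto simp: autom_def bij_def inj_def)
  then show ?thesis
    using braid_triple_autom[OF braid_triple_axioms, of f] assms(2)
    by (simp add: b4_triple_nontrivial_def b4_triple_nontrivial_axioms_def b4_triple_def autom_def)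
qed

lemma is_hom_bet:
  assumes "braid_triple a b c" "is_hom f"
  shows "braid_triple.bet (f a) (f b) (f c) = f (braid_triple.bet a b c)"
  using braid_triple.bet_def[OF braid_triple_autom[OF assms]] braid_triple.bet_def[OF assms(1)]
  by (simp add: is_homD(2)[OF assms(2)])

lemma trace_two:
  assumes "b4_triple_nontrivial a b c" shows "tr (sl_rep a) = 2"
proof -
  interpret b4_triple_nontrivial a b c by fact
  obtain l i where l: "e \<approx> om l * eps i * ginv (om l)" by (rule e_conj_eps)
  obtain h where h: "eps i = h * (\<beta> * \<beta>) * ginv h" using eps_conj by blast
  define g where "g = ginv (om l * h)"
  define f where "f x = g * x * ginv g" for x
  have f: "autom f" "is_hom f" using autom_conj[of g] unfolding f_def autom_def by auto
  interpret T: b4_triple_nontrivial "f a" "f b" "f c"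
    by (rule b4_triple_nontrivial_autom[OF assms f(1)])
  have "T.e = f e" by (simp only: is_hom_bet[OF braid_triple_axioms f(2)] is_homD(2)[OF f(2)])
  also have "f e \<approx> g * (om l * eps i * ginv (om l)) * ginv g"
    unfolding f_def by (intro ceq_left ceq_right l)
  also have "\<dots> = \<beta> * \<beta>" unfolding h g_def by (simp add: mult.assoc)
  finally have "T.e \<approx> \<beta> * \<beta>" .
  then have "tr (sl_rep (f a)) = 2" by (rule T.trace_two_aux)
  then show ?thesis unfolding f_def tr_sl_rep_conj .
qed

section \<open>Normalizing the matrices of a triple\<close>

lemma euclid: "\<exists>g. mat_y (sl_rep g) p q = 0"
proof (induction "nat (\<bar>p\<bar> + \<bar>q\<bar>)" arbitrary: p q rule: less_induct)
  case less
  have step: ?case if smaller: "nat (\<bar>mat_x (sl_rep h) p q\<bar> + \<bar>mat_y (sl_rep h) p q\<bar>) < nat (\<bar>p\<bar> + \<bar>q\<bar>)" for h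
  proof -
    obtain g where "mat_y (sl_rep g) (mat_x (sl_rep h) p q) (mat_y (sl_rep h) p q) = 0"
      using less[OF smaller] by blast
    then show ?thesis by (intro exI[of _ "g * h"]) (simp add: mat_xy_mult)
  qed
  have r: "sl_rep s1 = Mat 1 1 0 1" "sl_rep (ginv s1) = Mat 1 (- 1) 0 1"
    "sl_rep s2 = Mat 1 0 (- 1) 1" "sl_rep (ginv s2) = Mat 1 0 1 1"
    by (simp_all add: sl_rep_gens Amat_def Bmat_def)
  consider "q = 0" | "p = 0" | "p \<noteq> 0" "q \<noteq> 0" by blast
  then show ?case
  proof cases
    case 1
    then show ?thesis by (intro exI[of _ 1]) (simp add: one_mat_def)
  next
    case 2
    then show ?thesis by (intro exI[of _ \<beta>]) (simp add: sl_rep_bet)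
  next
    case 3
    \<comment> \<open>One step of the Euclidean algorithm, performed by \<open>Amat\<close>,
      \<open>Bmat\<close> or an inverse.\<close>
    then have "\<bar>p + q\<bar> < \<bar>p\<bar> \<or> \<bar>p - q\<bar> < \<bar>p\<bar> \<or> \<bar>q - p\<bar> < \<bar>q\<bar> \<or> \<bar>q + p\<bar> < \<bar>q\<bar>" by arith
    then show ?thesis
      using step[of s1] step[of "ginv s1"] step[of s2] step[of "ginv s2"] 3
      unfolding r by (auto simp: algebra_simps)
  qed
qed

lemma unipotent_sl_rep: "\<exists>g. sl_rep g = Mat 1 j 0 1"
proof -
  have p: "Amat ^ n = Mat 1 (int n) 0 1" for n
    by (induction n) (simp_all add: Amat_def one_mat_def)
  show ?thesis
  proof (cases "j \<ge> 0")
    case True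
    then show ?thesis by (intro exI[of _ "s1 ^ nat j"]) (simp add: sl_rep_gens p)
  next
    case False
    then show ?thesis by (intro exI[of _ "ginv (s1 ^ nat (- j))"]) (simp add: sl_rep_gens p)
  qed
qed

lemma sl_rep_normalize_aux:
  assumes "sl_rep a = Mat 1 1 0 1" "tr (sl_rep b) = 2" "tr (sl_rep a * sl_rep b) = 1"
  obtains g where "sl_rep (g * a * ginv g) = Amat" "sl_rep (g * b * ginv g) = Bmat"
proof -
  obtain p q r s where b: "sl_rep b = Mat p q r s" by (cases "sl_rep b")
  have rs: "s = 2 - p" "r = - 1" using assms b by auto
  have q: "q = p * p - 2 * p + 1" using det_sl_rep[of b] unfolding b rs det.simps by (simp add: algebra_simps)
  \<comment> \<open>An upper unipotent conjugation fixes the matrix of \<open>a\<close>; this one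
    turns the diagonal entry \<open>p\<close> into 1.\<close>
  obtain g where g: "sl_rep g = Mat 1 (p - 1) 0 1" using unipotent_sl_rep by blast
  show ?thesis
    by (rule that[of g]) (simp_all add: assms(1) b g rs q Amat_def Bmat_def algebra_simps)
qed

lemma mat_fixed_exists:
  assumes "det x = 1" "tr x = 2" obtains p q where "p \<noteq> 0 \<or> q \<noteq> 0" "mat_x x p q = p" "mat_y x p q = q"
proof (cases x)
  case (Mat a b c d)
  have d1: "d = 2 - a" and "a * d - b * c = 1" using assms Mat by auto
  then have d: "d = 2 - a" "a * (2 - a) - b * c = 1" by simp_all
  show ?thesis
  proof (cases "b = 0 \<and> a = 1")
    case True
    then show ?thesis using that[of 0 1] Mat d by simp
  next
    case False
    then show ?thesis using that[of b "1 - a"] Mat d by (auto simp: algebra_simps)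
  qed
qed

text \<open>Moving a fixed vector of the matrix of \<open>a\<close> onto the first axis makes that
  matrix upper unipotent with corner \<open>k\<close>. The traces give \<open>k * r = - 1\<close>,
  so \<open>k\<close> is 1 or -1, and \<open>mirror\<close> reduces the second case to the
  first.\<close>

lemma sl_rep_normalize:
  assumes "b4_triple_nontrivial a b c"
  obtains f where "autom f" "sl_rep (f a) = Amat" "sl_rep (f b) = Bmat"
proof -
  interpret b4_triple_nontrivial a b c by fact
  have tr: "tr (sl_rep a) = 2" by (rule trace_two[OF assms])
  have trb: "tr (sl_rep b) = 2"
    using mat_braid_trace[of "sl_rep a" "sl_rep b"] arg_cong[OF aba, of sl_rep] tr by simp
  obtain p q where v: "p \<noteq> 0 \<or> q \<noteq> 0" "mat_x (sl_rep a) p q = p" "mat_y (sl_rep a) p q = q"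
    using mat_fixed_exists[OF det_sl_rep tr] .
  obtain g where g: "mat_y (sl_rep g) p q = 0" using euclid by blast
  let ?d = "mat_x (sl_rep g) p q"
  let ?a = "g * a * ginv g" and ?b = "g * b * ginv g"
  have ginv_v: "mat_x (sl_rep (ginv g)) ?d 0 = p" "mat_y (sl_rep (ginv g)) ?d 0 = q"
  proof -
    have "mat_x (sl_rep (ginv g * g)) p q = p" "mat_y (sl_rep (ginv g * g)) p q = q"
      unfolding ginv_left by (simp_all add: one_mat_def)
    then show "mat_x (sl_rep (ginv g)) ?d 0 = p" "mat_y (sl_rep (ginv g)) ?d 0 = q"
      by (simp_all only: sl_rep_simps(2) mat_xy_mult g)
  qed
  have d0: "?d \<noteq> 0" using ginv_v v(1) by (cases "sl_rep (ginv g)") auto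
  have fa: "mat_x (sl_rep ?a) ?d 0 = ?d" "mat_y (sl_rep ?a) ?d 0 = 0"
    by (simp_all only: sl_rep_simps(2) mat_xy_mult ginv_v v g)
  obtain x k y z where A: "sl_rep ?a = Mat x k y z" by (cases "sl_rep ?a")
  have xy: "x = 1" "y = 0" using fa d0 unfolding A by auto
  have "z = 1" using det_sl_rep[of ?a] unfolding A xy by simp
  then have A: "sl_rep ?a = Mat 1 k 0 1" using A xy by simp
  obtain x' y' r z' where B: "sl_rep ?b = Mat x' y' r z'" by (cases "sl_rep ?b")
  have tB: "tr (sl_rep ?b) = 2" using trb by (simp only: tr_sl_rep_conj)
  have "?a * ?b = g * (a * b) * ginv g" by (simp add: mult.assoc)
  then have "tr (sl_rep (?a * ?b)) = 1" using tr_ab by (simp only: tr_sl_rep_conj sl_rep_simps(2)[of a b])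
  then have tAB: "tr (sl_rep ?a * sl_rep ?b) = 1" by (simp only: sl_rep_simps(2))
  have "k * r = - 1" using tAB tB unfolding A B by simp
  then have k: "k = 1 \<or> k = - 1" by (metis minus_mult_minus mult_minus_right zmult_eq_1_iff minus_equation_iff)
  show ?thesis
  proof (cases "k = 1")
    case True
    obtain h where h: "sl_rep (h * ?a * ginv h) = Amat" "sl_rep (h * ?b * ginv h) = Bmat"
      by (rule sl_rep_normalize_aux[OF _ tB tAB]) (use A True in simp)
    show ?thesis
    proof (rule that[of "(\<lambda>x. h * x * ginv h) \<circ> (\<lambda>x. g * x * ginv g)"])
      show "autom ((\<lambda>x. h * x * ginv h) \<circ> (\<lambda>x. g * x * ginv g))"
        by (intro autom_comp autom_conj)
    qed (use h in simp_all)
  next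
    case False
    then have k: "k = - 1" using k by simp
    have "sl_rep (mirror ?a) = Mat 1 1 0 1" unfolding sl_rep_mirror A k by simp
    moreover have "tr (sl_rep (mirror ?b)) = 2" using tB unfolding sl_rep_mirror B by simp
    moreover have "tr (sl_rep (mirror ?a) * sl_rep (mirror ?b)) = 1"
      using tAB unfolding sl_rep_mirror A B by simp
    ultimately obtain h where h: "sl_rep (h * mirror ?a * ginv h) = Amat" "sl_rep (h * mirror ?b * ginv h) = Bmat"
      by (rule sl_rep_normalize_aux)
    show ?thesis
    proof (rule that[of "(\<lambda>x. h * x * ginv h) \<circ> (mirror \<circ> (\<lambda>x. g * x * ginv g))"])
      show "autom ((\<lambda>x. h * x * ginv h) \<circ> (mirror \<circ> (\<lambda>x. g * x * ginv g)))"
        by (intro autom_comp autom_conj autom_mirror)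
    qed (use h in simp_all)
  qed
qed

section \<open>Classification of braid triples\<close>

text \<open>Conjugation by \<open>bet\<close> takes \<open>a\<close> to \<open>b\<close> and
  \<open>b\<close> to \<open>c\<close>, so these are congruent to \<open>s2\<close> and
  \<open>s3\<close>. The three central factors agree because \<open>a\<close>, \<open>b\<close> and
  \<open>c\<close> have equal exponent sums.\<close>

lemma (in b4_triple) standard_of_ceq:
  assumes "bet \<approx> \<beta>" "a \<approx> s1" shows "standard a b c"
proof -
  have conj: "x \<approx> s'" if "bet * y = x * bet" "\<beta> * s = s' * \<beta>" "y \<approx> s" for x y s s'
  proof -
    have "x * \<beta> \<approx> x * bet" by (rule ceq_left[OF ceq_sym[OF assms(1)]])
    also have "x * bet \<approx> \<beta> * s" using ceq_mult[OF assms(1) that(3)] that(1) by simp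
    finally show ?thesis using that(2) ceq_cancel_right by simp
  qed
  have b: "b \<approx> s2" using conj[OF bet_a S.bet_a assms(2)] .
  have c: "c \<approx> s3" using conj[OF bet_b S.bet_b b] .
  obtain t where t: "t \<in> Cz" "a = s1 * t" using assms(2) unfolding ceq_def by blast
  obtain t2 where t2: "t2 \<in> Cz" "b = s2 * t2" using b unfolding ceq_def by blast
  obtain t3 where t3: "t3 \<in> Cz" "c = s3 * t3" using c unfolding ceq_def by blast
  have eq: "t' = t" if "t' \<in> Cz" "expo t' = expo t" for t'
  proof -
    have "t' * ginv t = 1"
      using that t(1) by (intro expo_Cz Cz_mult Cz_ginv) simp_all
    then show ?thesis by (metis ginv_unique ginv_ginv ginv_right mult_right_cancel_group)
  qed
  have "t2 = t" "t3 = t" using eq t2 t3 expo_eq t(2) by (simp_all add: expo)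
  moreover have "autom (\<lambda>x. x)" by (simp add: autom_def is_hom_def bij_id[unfolded id_def])
  ultimately show ?thesis unfolding standard_def using t t2 t3 by blast
qed

text \<open>Conjugation by \<open>\<gamma>\<beta>\<close>.\<close>

definition th :: "tri list \<Rightarrow> tri list" where "th w = map rot (concat (map bsub w))"

lemma gam_bet_om: "\<gamma> * \<beta> * om w \<approx> om (th w) * (\<gamma> * \<beta>)"
proof -
  have "\<gamma> * \<beta> * om w \<approx> \<gamma> * om (concat (map bsub w)) * \<beta>"
    unfolding mult.assoc by (rule ceq_left[OF bet_om])
  then show ?thesis unfolding gam_om th_def by (simp only: mult.assoc)
qed

lemma th_append: "th (v @ w) = th v @ th w"
  by (simp add: th_def)

lemma th_th: "th (th w) = concat (map t2 w)"
proof (induction w)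
  case (Cons i w)
  have "th (th (i # w)) = th (th [i]) @ th (th w)" using th_append[of "[i]" w] th_append by simp
  moreover have "th (th [i]) = t2 i" by (cases i) (simp_all add: th_def)
  ultimately show ?case using Cons by simp
qed (simp add: th_def)

lemma even_length_th: "even (length (th w)) = even (length w)"
proof (induction w)
  case (Cons i w)
  have "th (i # w) = th [i] @ th w" using th_append[of "[i]" w] by simp
  moreover have "odd (length (th [i]))" by (cases i) (simp_all add: th_def)
  ultimately show ?case using Cons by simp
qed (simp add: th_def)

context b4_triple_nontrivial
begin

text \<open>Writing \<open>bet\<close> as \<open>om w * \<beta>\<close> modulo the centre, its
  commutation with \<open>e\<close> says that \<open>w @ bsub i\<close> and \<open>i # w\<close>
  agree. Counting letters modulo 2 forces \<open>i = T0\<close>, and an even word commuting with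
  \<open>T0\<close> is trivial.\<close>

lemma bet_standard:
  assumes "sl_rep a = Amat" "sl_rep b = Bmat" "e \<approx> eps i"
  shows "bet \<approx> \<beta>"
proof -
  have slb: "sl_rep bet = sl_rep \<beta>"
    by (simp add: bet_def beta_def assms(1,2) sl_a_c[symmetric] sl_rep_gens)
  have q1: "sl_rep (bet * ginv \<beta>) = 1" by (simp add: slb adj_right)
  obtain w where w: "bet * ginv \<beta> \<approx> om w" using sl_rep_kernel q1 by blast
  have bw: "bet \<approx> om w * \<beta>" using ceq_right[OF w, of \<beta>] by (simp add: mult.assoc)
  have "om w * om (bsub i) * \<beta> \<approx> om w * (\<beta> * eps i)"
    unfolding mult.assoc by (rule ceq_left[OF ceq_sym[OF bet_eps]])
  also have "\<dots> \<approx> bet * e"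
    unfolding mult.assoc[symmetric] using ceq_mult[OF ceq_sym[OF bw] ceq_sym[OF assms(3)]] by (simp only: mult.assoc)
  also have "bet * e = e * bet" by (simp only: mult.assoc)
  also have "\<dots> \<approx> eps i * (om w * \<beta>)" by (rule ceq_mult[OF assms(3) bw])
  finally have "om (w @ bsub i) * \<beta> \<approx> om (i # w) * \<beta>" by (simp only: ev_simps mult.assoc)
  then have c: "om (w @ bsub i) \<approx> om (i # w)" by (rule ceq_cancel_right)
  have i: "i = T0"
  proof (cases i)
    case T1
    then show ?thesis using om_ceq_parity[OF c, of T1] by simp
  next
    case T2
    then show ?thesis using om_ceq_parity[OF c, of T2] by simp
  qed
  have "om (T0 # w) \<approx> om (w @ [T0])" using ceq_sym[OF c] unfolding i bsub.simps .
  then have "om w \<approx> 1" using even_length_iff(1)[OF w q1] by (rule commute_eps0)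
  then have "om w * \<beta> \<approx> 1 * \<beta>" by (rule ceq_right)
  then show ?thesis using ceq_trans[OF bw] by simp
qed

text \<open>Write \<open>gam\<close> as \<open>om w * \<gamma>\<close> modulo the centre. Centrality
  of \<open>gam ^ 3\<close> is the equation of \<open>rot_product_trivial\<close>. Commutation of
  \<open>e\<close> with \<open>gam * bet * gam\<close> makes \<open>w @ th w\<close> commute with
  \<open>T0\<close>, hence trivial.\<close>

lemma gam_standard:
  assumes "sl_rep a = Amat" "bet \<approx> \<beta>"
  shows "gam \<approx> \<gamma> \<or> gam \<approx> eps T0 * eps T1 * \<gamma>"
proof -
  have "sl_rep gam = sl_rep \<gamma>"
    by (simp add: gam_def gamma_def assms(1) ceq_sl_rep[OF assms(2)] sl_rep_gens)
  then have k1: "sl_rep (gam * ginv \<gamma>) = 1" by (simp add: adj_right)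
  obtain w where w: "gam * ginv \<gamma> \<approx> om w" "distinct_adj w"
    using reduced_representative k1 by metis
  have gw: "gam \<approx> om w * \<gamma>" using ceq_right[OF w(1), of \<gamma>] by (simp add: mult.assoc)
  have "gam ^ 3 = e * e" by (simp only: gam3 bet4_e)
  then have g3: "gam * (gam * gam) \<approx> 1"
    using e_square_central by (simp add: ceq_one_iff numeral_eq_Suc)
  have g0: "\<gamma> * (\<gamma> * \<gamma>) \<approx> 1"
    using S.gam3 by (simp add: ceq_one_iff numeral_eq_Suc) (metis Cz_zeta1 S.bet_pow4)
  have "om (w @ map rot w @ map rot (map rot w)) * (\<gamma> * (\<gamma> * \<gamma>))
      = om w * \<gamma> * (om w * \<gamma> * (om w * \<gamma>))"
  proof -
    have push: "\<gamma> * (om v * x) = om (map rot v) * (\<gamma> * x)" for v x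
      using gam_om[of v] by (simp only: mult.assoc[symmetric])
    show ?thesis by (simp only: ev_simps mult.assoc push)
  qed
  also have "\<dots> \<approx> gam * (gam * gam)" by (intro ceq_mult ceq_sym[OF gw])
  also have "\<dots> \<approx> 1 * (\<gamma> * (\<gamma> * \<gamma>))" using ceq_trans[OF g3 ceq_sym[OF g0]] by simp
  finally have r1: "om (w @ map rot w @ map rot (map rot w)) \<approx> 1" by (rule ceq_cancel_right)
  define x where "x = \<gamma> * (\<beta> * \<gamma>)"
  have x: "eps T0 * x = x * eps T0"
    using S.bet2_gam_bet_gam unfolding x_def by (simp only: eps.simps mult.assoc)
  have gbg: "gam * (bet * gam) \<approx> om (w @ th w) * x"
  proof -
    have "gam * (bet * gam) \<approx> om w * \<gamma> * (\<beta> * (om w * \<gamma>))" by (intro ceq_mult gw assms(2))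
    also have "\<dots> = om w * ((\<gamma> * \<beta> * om w) * \<gamma>)" by (simp only: mult.assoc)
    also have "\<dots> \<approx> om w * (om (th w) * (\<gamma> * \<beta>) * \<gamma>)" by (intro ceq_left ceq_right gam_bet_om)
    finally show ?thesis by (simp add: x_def mult.assoc)
  qed
  have e0: "e \<approx> eps T0" using ceq_mult[OF assms(2) assms(2)] by simp
  have "om (T0 # (w @ th w)) * x = eps T0 * (om (w @ th w) * x)"
    by (simp only: ev_simps mult.assoc)
  also have "\<dots> \<approx> e * (gam * (bet * gam))" by (rule ceq_mult[OF ceq_sym[OF e0] ceq_sym[OF gbg]])
  also have "e * (gam * (bet * gam)) = gam * (bet * gam) * e"
    using bet2_gam_bet_gam by (simp only: mult.assoc)
  also have "\<dots> \<approx> om (w @ th w) * x * eps T0" by (rule ceq_mult[OF gbg e0])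
  also have "\<dots> = om ((w @ th w) @ [T0]) * x"
    unfolding mult.assoc x[symmetric] by (simp only: ev_simps mult.assoc mult_1_right)
  finally have "om (T0 # (w @ th w)) \<approx> om ((w @ th w) @ [T0])" by (rule ceq_cancel_right)
  then have t1: "om (w @ th w) \<approx> 1"
    by (rule commute_eps0) (use even_length_iff(1)[OF w(1) k1] in \<open>simp add: even_length_th\<close>)
  \<comment> \<open>Since \<open>th\<close> inverts \<open>w\<close>, applying it twice returns
    \<open>w\<close>, and \<open>t2_fixed\<close> excludes \<open>T2\<close>.\<close>
  have "om (th (w @ th w)) * (\<gamma> * \<beta>) \<approx> \<gamma> * \<beta> * om (w @ th w)" by (rule ceq_sym[OF gam_bet_om])
  also have "\<dots> \<approx> \<gamma> * \<beta> * 1" by (rule ceq_left[OF t1])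
  finally have "om (th (w @ th w)) * (\<gamma> * \<beta>) \<approx> 1 * (\<gamma> * \<beta>)" by simp
  then have "om (th (w @ th w)) \<approx> 1" by (rule ceq_cancel_right)
  then have t2: "om (th w) * om (th (th w)) \<approx> 1" by (simp only: th_append ev_simps)
  have "1 * om (th (th w)) \<approx> om (w @ th w) * om (th (th w))"
    by (rule ceq_right[OF ceq_sym[OF t1]])
  also have "\<dots> = om w * (om (th w) * om (th (th w)))" by (simp only: ev_simps mult.assoc)
  also have "\<dots> \<approx> om w * 1" by (rule ceq_left[OF t2])
  finally have "om (th (th w)) \<approx> om w" by simp
  then have "red (concat (map t2 w)) = w"
    unfolding om_ceq_reduced th_th red_reduced[OF w(2)] .
  then have "w = [] \<or> w = [T0, T1]"
    using t2_fixed[OF w(2)] rot_product_trivial[OF w(2) _ r1] by blast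
  then show ?thesis using gw by (auto simp: mult.assoc simp del: eps.simps)
qed

lemma standard_normalized_aux:
  assumes "sl_rep a = Amat" "sl_rep b = Bmat" "e \<approx> eps i" shows "standard a b c"
proof -
  have b: "bet \<approx> \<beta>" by (rule bet_standard[OF assms])
  have a: "ginv bet * gam = a" by (simp add: gam_def)
  have s1: "s1 = ginv \<beta> * \<gamma>" by (simp add: gamma_def)
  consider "gam \<approx> \<gamma>" | "gam \<approx> eps T0 * eps T1 * \<gamma>" using gam_standard[OF assms(1) b] by blast
  then show ?thesis
  proof cases
    case 1
    then have "ginv bet * gam \<approx> s1" unfolding s1 using b by (intro ceq_mult ceq_ginv)
    then have "a \<approx> s1" by (simp only: a)
    then show ?thesis using b by (rule standard_of_ceq[rotated])
  next
    case 2
    \<comment> \<open>This conjugation fixes \<open>\<beta>\<close> and carries the second solution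
      to the standard one.\<close>
    define f where "f x = ginv (\<beta> * \<beta>) * x * ginv (ginv (\<beta> * \<beta>))" for x
    have f: "autom f" unfolding f_def by (rule autom_conj)
    then have fh: "is_hom f" by (simp add: autom_def)
    interpret T: b4_triple "f a" "f b" "f c"
      using braid_triple_autom[OF braid_triple_axioms fh] by (simp add: b4_triple_def)
    have "T.bet = f bet" by (rule is_hom_bet[OF braid_triple_axioms fh])
    also have "f bet \<approx> f \<beta>" unfolding f_def by (intro ceq_left ceq_right b)
    also have "f \<beta> = \<beta>" unfolding f_def by (simp add: mult.assoc)
    finally have Tb: "T.bet \<approx> \<beta>" .
    have "ginv bet * gam \<approx> ginv \<beta> * (eps T0 * eps T1 * \<gamma>)"
      using b 2 by (intro ceq_mult ceq_ginv)
    also have "\<dots> = \<beta> * \<gamma> * (\<beta> * \<beta>)" by (simp add: mult.assoc)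
    finally have "a \<approx> \<beta> * \<gamma> * (\<beta> * \<beta>)" by (simp only: a)
    then have "f a \<approx> f (\<beta> * \<gamma> * (\<beta> * \<beta>))" unfolding f_def by (intro ceq_left ceq_right)
    also have "\<dots> = s1 * \<zeta>" unfolding f_def s1 by (simp only: S.bet_pow4 ginv_mult ginv_ginv mult.assoc ginv_left_assoc)
    also have "\<dots> \<approx> s1" by (rule ceq_mult_Cz[OF Cz_zeta1])
    finally have "standard (f a) (f b) (f c)" by (rule T.standard_of_ceq[OF Tb])
    then show ?thesis by (rule standard_autom[OF f])
  qed
qed

lemma standard_normalized:
  assumes "sl_rep a = Amat" "sl_rep b = Bmat" shows "standard a b c"
proof -
  obtain l i where l: "e \<approx> om l * eps i * ginv (om l)" by (rule e_conj_eps)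
  define g where "g = ginv (om l)"
  define f where "f x = g * x * ginv g" for x
  have f: "autom f" unfolding f_def by (rule autom_conj)
  then have fh: "is_hom f" by (simp add: autom_def)
  interpret T: b4_triple_nontrivial "f a" "f b" "f c"
    by (rule b4_triple_nontrivial_autom[OF b4_triple_nontrivial_axioms f])
  \<comment> \<open>The matrix of \<open>g\<close> is scalar, so conjugating \<open>e\<close> to
    \<open>eps i\<close> preserves the matrix normalization.\<close>
  have "sl_rep g = 1 \<or> sl_rep g = - 1"
  proof -
    have "adj 1 = 1" "adj (- 1) = - 1" by (simp_all add: one_mat_def)
    moreover have "sl_rep (om l) = 1 \<or> sl_rep (om l) = - 1"
      unfolding sl_rep_om by (cases "even (length l)") simp_all
    ultimately show ?thesis unfolding g_def sl_rep_ginv by metis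
  qed
  then have sf: "sl_rep (f x) = sl_rep x" for x
    unfolding f_def sl_rep_conj by (elim disjE) (cases "sl_rep x"; simp add: one_mat_def)+
  have "T.e = f e" by (simp only: is_hom_bet[OF braid_triple_axioms fh] is_homD(2)[OF fh])
  also have "f e \<approx> g * (om l * eps i * ginv (om l)) * ginv g"
    unfolding f_def by (intro ceq_left ceq_right l)
  also have "\<dots> = eps i" unfolding g_def by (simp add: mult.assoc)
  finally have "standard (f a) (f b) (f c)"
    using T.standard_normalized_aux sf assms by metis
  then show ?thesis by (rule standard_autom[OF f])
qed

end

theorem braid_triple_classification:
  assumes "braid_triple a b c" "a \<noteq> c" shows "standard a b c"
proof -
  have n: "b4_triple_nontrivial a b c"
    using assms by (simp add: b4_triple_nontrivial_def b4_triple_def b4_triple_nontrivial_axioms_def)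
  obtain f where f: "autom f" "sl_rep (f a) = Amat" "sl_rep (f b) = Bmat"
    by (rule sl_rep_normalize[OF n])
  have "standard (f a) (f b) (f c)"
    by (rule b4_triple_nontrivial.standard_normalized[OF b4_triple_nontrivial_autom[OF n f(1)] f(2,3)])
  then show ?thesis by (rule standard_autom[OF f(1)])
qed

section \<open>Homomorphisms of the braid group\<close>

lemma hom_ginv: "is_hom f \<Longrightarrow> f (ginv x) = ginv (f (x :: b4) :: b4)"
  by (rule ginv_unique[symmetric]) (rule is_homD(5))

lemma hom_ext:
  fixes f g :: "b4 \<Rightarrow> b4"
  assumes "is_hom f" "is_hom g" "f s1 = g s1" "f s2 = g s2" "f s3 = g s3"
  shows "f x = g x"
  by (induction x rule: b4_induct)
    (simp_all only: is_homD(1,2)[OF assms(1)] is_homD(1,2)[OF assms(2)] hom_ginv[OF assms(1)]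
      hom_ginv[OF assms(2)] assms(3-5))

definition b4_dec :: "braid \<Rightarrow> b4" where "b4_dec = inv_into UNIV b4_class"

lemma b4_dec_class [simp]: "b4_dec (b4_class x) = x"
  unfolding b4_dec_def by (rule inv_into_f_f) (simp_all add: inj_def b4_class_inj)

lemma b4_class_dec: "X \<in> carrier (braid_group 4) \<Longrightarrow> b4_class (b4_dec X) = X"
  using b4_class_surj by fastforce

definition b4_lift :: "(b4 \<Rightarrow> b4) \<Rightarrow> braid \<Rightarrow> braid" where
  "b4_lift f X = b4_class (f (b4_dec X))"

lemma b4_lift_class [simp]: "b4_lift f (b4_class x) = b4_class (f x)"
  by (simp add: b4_lift_def)

lemma b4_lift_hom: "is_hom f \<Longrightarrow> b4_lift f \<in> hom (braid_group 4) (braid_group 4)"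
proof (rule homI)
  assume f: "is_hom f"
  show "b4_lift f X \<in> carrier (braid_group 4)" for X
    by (simp add: b4_lift_def b4_class_carrier)
  show "b4_lift f (X \<otimes>\<^bsub>braid_group 4\<^esub> Y) = b4_lift f X \<otimes>\<^bsub>braid_group 4\<^esub> b4_lift f Y"
    if X: "X \<in> carrier (braid_group 4)" and Y: "Y \<in> carrier (braid_group 4)" for X Y
  proof -
    obtain x y where "X = b4_class x" "Y = b4_class y"
      using b4_class_surj[OF X] b4_class_surj[OF Y] by blast
    then show ?thesis by (simp add: is_homD(2)[OF f] flip: b4_class_mult)
  qed
qed

lemma b4_lift_iso:
  assumes "autom f" shows "b4_lift f \<in> iso (braid_group 4) (braid_group 4)"
proof -
  have f: "is_hom f" "bij f" using assms by (auto simp: autom_def)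
  have "bij_betw (b4_lift f) (carrier (braid_group 4)) (carrier (braid_group 4))"
  proof (rule bij_betw_byWitness[where f' = "b4_lift (inv_into UNIV f)"])
    have c: "b4_lift g ` carrier (braid_group 4) \<subseteq> carrier (braid_group 4)" for g
      by (auto simp: b4_lift_def b4_class_carrier)
    show "b4_lift f ` carrier (braid_group 4) \<subseteq> carrier (braid_group 4)"
      "b4_lift (inv_into UNIV f) ` carrier (braid_group 4) \<subseteq> carrier (braid_group 4)"
      by (rule c)+
    show "\<forall>X\<in>carrier (braid_group 4). b4_lift (inv_into UNIV f) (b4_lift f X) = X"
    proof
      fix X assume "X \<in> carrier (braid_group 4)"
      then obtain x where "X = b4_class x" using b4_class_surj by blast
      then show "b4_lift (inv_into UNIV f) (b4_lift f X) = X" using f(2) by (simp add: bij_is_inj)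
    qed
    show "\<forall>X\<in>carrier (braid_group 4). b4_lift f (b4_lift (inv_into UNIV f) X) = X"
    proof
      fix X assume "X \<in> carrier (braid_group 4)"
      then obtain x where "X = b4_class x" using b4_class_surj by blast
      then show "b4_lift f (b4_lift (inv_into UNIV f) X) = X"
        using f(2) by (simp add: bij_is_surj surj_f_inv_f)
    qed
  qed
  then show ?thesis using b4_lift_hom[OF f(1)] by (simp add: iso_def)
qed

lemma exceptional_factor:
  assumes "is_hom r" "r s1 = r s3"
  shows "\<exists>\<psi>\<in>hom (braid_group 3) (braid_group 4).
    \<forall>x\<in>carrier (braid_group 4). b4_lift r x = \<psi> (exceptional x)"
proof -
  interpret T: braid_triple "r s1" "r s2" "r s3"
    by (rule braid_triple_autom[OF S.braid_triple_axioms assms(1)])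
  define p where "p i = (if i = 1 then r s1 else r s2)" for i :: nat
  define f where "f l = (case l of Gen i \<Rightarrow> p i | Inv i \<Rightarrow> ginv (p i))" for l :: "nat letter"
  have fr: "braid_respecting 3 f"
    unfolding braid_respecting_def
  proof (intro conjI ballI impI)
    fix i :: nat assume i: "i \<in> {1..<3}"
    show "f (Gen i) * f (Inv i) = 1" "f (Inv i) * f (Gen i) = 1" by (simp_all add: f_def)
    show "f (Gen i) * f (Gen (i + 1)) * f (Gen i) = f (Gen (i + 1)) * f (Gen i) * f (Gen (i + 1))"
      if "i + 1 \<in> {1..<3}"
    proof -
      have "i = 1" using that i by auto
      then show ?thesis using T.aba by (simp add: f_def p_def)
    qed
    show "f (Gen i) * f (Gen j) = f (Gen j) * f (Gen i)" if "j \<in> {1..<3}" "i + 1 < j" for j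
      using i that by auto
  qed
  \<comment> \<open>The chosen representative does not matter, because \<open>f\<close> respects the
    relations of the three-strand group.\<close>
  define \<psi> where "\<psi> X = b4_class (ev f (SOME w. w \<in> X))" for X :: braid
  have psi: "\<psi> (braid_class 3 w) = b4_class (ev f w)" if "w \<in> braid_words 3" for w
  proof -
    have "(SOME v. v \<in> braid_class 3 w) \<in> braid_class 3 w"
      using that by (intro someI[of "\<lambda>v. v \<in> braid_class 3 w" w]) (simp add: braid_class_def braid_rel_def)
    then have "braid_eq 3 w (SOME v. v \<in> braid_class 3 w)"
      by (simp add: braid_class_def braid_rel_def)
    from ev_braid_eq[OF fr this] show ?thesis by (simp add: \<psi>_def)
  qed
  have "\<psi> \<in> hom (braid_group 3) (braid_group 4)"
  proof (rule homI)
    show "\<psi> X \<in> carrier (braid_group 4)" for X by (simp add: \<psi>_def b4_class_carrier)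
    show "\<psi> (X \<otimes>\<^bsub>braid_group 3\<^esub> Y) = \<psi> X \<otimes>\<^bsub>braid_group 4\<^esub> \<psi> Y"
      if X: "X \<in> carrier (braid_group 3)" and Y: "Y \<in> carrier (braid_group 3)" for X Y
    proof -
      obtain v w where "v \<in> braid_words 3" "X = braid_class 3 v" "w \<in> braid_words 3" "Y = braid_class 3 w"
        using X Y by (auto simp: carrier_braid_group)
      then show ?thesis by (simp add: braid_mult_class psi flip: b4_class_mult)
    qed
  qed
  moreover have "b4_lift r x = \<psi> (exceptional x)" if "x \<in> carrier (braid_group 4)" for x
  proof -
    let ?g = "map_letter (\<lambda>i::nat. if i = 3 then 1 else i)"
    obtain w where w: "w \<in> braid_words 4" "x = braid_class 4 w"
      using \<open>x \<in> carrier _\<close> by (auto simp: carrier_braid_group)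
    have "r (abs_b4 w) = ev f (map ?g w)" using w(1)
    proof (induction w)
      case Nil
      then show ?case using is_homD(1)[OF assms(1)] by (simp add: one_b4_def)
    next
      case (Cons l w)
      then have w: "w \<in> braid_words 4" and l: "[l] \<in> braid_words 4"
        by (auto simp: braid_words_def)
      have "abs_b4 (l # w) = abs_b4 [l] * abs_b4 w" using w l by (simp add: abs_b4_mult)
      moreover have "r (abs_b4 [l]) = f (?g l)"
      proof (cases l)
        case (Gen i)
        then have "i = 1 \<or> i = 2 \<or> i = 3" using l by auto
        then show ?thesis unfolding Gen
          by (elim disjE) (simp_all add: b4_gens[simplified] f_def p_def assms(2))
      next
        case (Inv i)
        then have "i = 1 \<or> i = 2 \<or> i = 3" using l by auto
        then show ?thesis unfolding Inv
          by (elim disjE) (simp_all add: b4_gens[simplified] f_def p_def assms(2) hom_ginv[OF assms(1)])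
      qed
      ultimately show ?case using Cons.IH[OF w] by (simp add: is_homD(2)[OF assms(1)])
    qed
    moreover have "map ?g w \<in> braid_words 3"
      using exceptional_braid_eq[of w w] w(1) by simp
    moreover have "b4_lift r (braid_class 4 w) = b4_class (r (abs_b4 w))"
      using b4_lift_class[of r "abs_b4 w"] unfolding b4_class_abs[OF w(1)] .
    ultimately show ?thesis
      unfolding w(2) exceptional_class[OF w(1)] by (simp add: psi)
  qed
  ultimately show ?thesis by blast
qed

text \<open>The two ingredients of \<open>standard\<close> separate: \<open>h\<close> is the
  transvection of the identity by \<open>t\<close>, and \<open>r\<close> is \<open>f\<close>
  composed with \<open>h\<close>.\<close>

lemma standard_equivalent:
  assumes "is_hom r" "standard (r s1) (r s2) (r s3)"
  shows "hom_equivalent 4 (braid_group 4) (b4_lift r) (\<lambda>x. x)"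
proof -
  obtain f t where f: "autom f" "t \<in> Cz" "r s1 = f (s1 * t)" "r s2 = f (s2 * t)" "r s3 = f (s3 * t)"
    using assms(2) unfolding standard_def by blast
  have push: "t * (x * y) = x * (t * y)" "t * x = x * t" for x y
    by (metis Cz_commute[OF f(2)] mult.assoc) (rule Cz_commute[OF f(2)])
  have inv: "g * t * (ginv t * ginv g) = 1" "ginv t * ginv g * (g * t) = 1" for g
    by (simp_all add: mult.assoc)
  \<comment> \<open>Both sides of each braid relation acquire the same power of the central
    \<open>t\<close>, so the relations persist.\<close>
  have rel: "x * t * (y * t) * (z * t) = x * y * z * (t * (t * t))" "x * t * (y * t) = x * y * (t * t)" for x y z
    by (simp_all only: mult.assoc push(1)[of y] push(1)[of z])
  obtain h where h: "h 1 = 1" "\<And>x y. h (x * y) = h x * h y" "h s1 = s1 * t" "h s2 = s2 * t" "h s3 = s3 * t"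
    by (rule b4_hom_exists[of "s1 * t" "s2 * t" "s3 * t" "ginv t * ginv s1" "ginv t * ginv s2" "ginv t * ginv s3"])
      (simp only: rel(1) braid_relations, simp only: rel(1) braid_relations,
        simp only: rel(2) braid_relations, simp_all only: inv)
  have hh: "is_hom h" using h by (simp add: is_hom_def)
  have fh: "is_hom f" using f(1) by (simp add: autom_def)
  have "is_hom (\<lambda>x. f (h x))" using h fh by (simp add: is_hom_def)
  then have r: "r x = f (h x)" for x
    using hom_ext[OF assms(1), of "\<lambda>x. f (h x)"] f(3-5) h(3-5) by simp
  have "transvection 4 (braid_group 4) (b4_lift h) (\<lambda>x. x)"
    unfolding transvection_def
  proof (intro conjI bexI[of _ "b4_class t"] ballI)
    show "b4_lift h \<in> hom (braid_group 4) (braid_group 4)" by (rule b4_lift_hom[OF hh])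
    show "b4_class t \<in> carrier (braid_group 4)" by (rule b4_class_carrier)
    fix i :: nat assume "i \<in> {1..<4}"
    then have "i = 1 \<or> i = 2 \<or> i = 3" by auto
    then show "b4_lift h (braid_gen 4 i) = braid_gen 4 i \<otimes>\<^bsub>braid_group 4\<^esub> b4_class t"
      by (elim disjE) (simp_all only: b4_class_gens[symmetric] b4_lift_class h b4_class_mult)
  qed
  moreover have "almost_conjugate 4 (braid_group 4) (b4_lift r) (b4_lift h)"
    unfolding almost_conjugate_def
  proof (intro bexI[of _ "b4_lift f"] ballI)
    fix X assume "X \<in> carrier (braid_group 4)"
    then obtain x where "X = b4_class x" using b4_class_surj by blast
    then show "b4_lift r X = b4_lift f (b4_lift h X)" by (simp add: r)
  qed (rule b4_lift_iso[OF f(1)])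
  ultimately show ?thesis unfolding hom_equivalent_def by blast
qed

theorem theorem8p4:
  fixes \<rho> :: "braid \<Rightarrow> braid"
  assumes "\<rho> \<in> hom (braid_group 4) (braid_group 4)"
  shows "(\<exists>\<psi>\<in>hom (braid_group 3) (braid_group 4).
            \<forall>x\<in>carrier (braid_group 4). \<rho> x = \<psi> (exceptional x)) \<or>
         hom_equivalent 4 (braid_group 4) \<rho> (\<lambda>x. \<one>\<^bsub>braid_group 4\<^esub>) \<or>
         hom_equivalent 4 (braid_group 4) \<rho> (\<lambda>x. x)"
proof -
  define r where "r x = b4_dec (\<rho> (b4_class x))" for x
  have cr: "b4_class (r x) = \<rho> (b4_class x)" for x
    unfolding r_def by (rule b4_class_dec) (rule hom_in_carrier[OF assms b4_class_carrier])
  have "r (x * y) = r x * r y" for x y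
  proof -
    have "b4_class (r (x * y)) = b4_class (r x * r y)"
      by (simp only: cr b4_class_mult hom_mult[OF assms b4_class_carrier b4_class_carrier])
    then show ?thesis by (simp only: b4_class_inj)
  qed
  moreover from this have "r 1 = 1" by (metis mult_1_right mult_left_cancel_group)
  ultimately have rh: "is_hom r" by (simp add: is_hom_def)
  have eq: "\<rho> X = b4_lift r X" if "X \<in> carrier (braid_group 4)" for X
    using b4_class_surj[OF that] cr by auto
  show ?thesis
  \<comment> \<open>Maps equivalent to the trivial one take equal values on all generators, so they
    fall under the first case.\<close>
  proof (cases "r s1 = r s3")
    case True
    then show ?thesis using exceptional_factor[OF rh] eq by simp
  next
    case False
    have "braid_triple (r s1) (r s2) (r s3)"
      by (rule braid_triple_autom[OF S.braid_triple_axioms rh])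
    then have "standard (r s1) (r s2) (r s3)" using False by (rule braid_triple_classification)
    then have "hom_equivalent 4 (braid_group 4) (b4_lift r) (\<lambda>x. x)" by (rule standard_equivalent[OF rh])
    then have "hom_equivalent 4 (braid_group 4) \<rho> (\<lambda>x. x)"
    proof -
      have gen: "b4_lift r (braid_gen 4 i) = \<rho> (braid_gen 4 i)" if "i \<in> {1..<4}" for i
        using eq braid_gen_closed[OF that] by simp
      have "almost_conjugate 4 (braid_group 4) \<rho> f" if "almost_conjugate 4 (braid_group 4) (b4_lift r) f" for f
        using that eq unfolding almost_conjugate_def by simp
      moreover have "transvection 4 (braid_group 4) f \<rho>" if "transvection 4 (braid_group 4) f (b4_lift r)" for f
        using that gen unfolding transvection_def by simp
      ultimately show ?thesis
        using \<open>hom_equivalent 4 _ (b4_lift r) _\<close> unfolding hom_equivalent_def by blast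
    qed
    then show ?thesis by blast
  qed
qed

end
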